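(* Let $p$ be an odd prime different from $3$ and let $k\ge 1$, $\alpha\ge 1$ be integers. Then $U^{k}(\mathbb{Z}_{p^{\alpha}})$ is a boolean ring if and only if $\alpha<k$ and $U^{k-\alpha+1}(\mathbb{Z}_{p})$ is a boolean ring. Moreover, in this case, $$U^{k}(\mathbb{Z}_{p^{\alpha}})\approx U^{k-\alpha+1}(\mathbb{Z}_{p}).$$
   Context: For an integer $n\ge 1$, $\mathbb{Z}_n$ is the ring of integers modulo $n$ ($\mathbb{Z}_1=\{0\}$). For a finite commutative ring $R$ with identity (the zero ring is allowed, with $U(\{0\})=\{0\}$), $U(R)$ is its group of units. Since $U(R)$ is a finite abelian group, it is isomorphic to a product $\mathbb{Z}_{n_1}\times\cdots\times\mathbb{Z}_{n_i}$ of cyclic groups, and $U(R)$ is regarded as a ring by transporting the ring structure of $\mathbb{Z}_{n_1}\oplus\cdots\oplus\mathbb{Z}_{n_i}$ (up to ring isomorphism this does not depend on the chosen decomposition). The $k$-th (generalized) group of units is defined by $U^0(R)=R$, $U^1(R)=U(R)$ and $U^k(R)=U(U^{k-1}(R))$, where $U^{k-1}(R)$ is viewed as a ring in this way. The symbol $\approx$ denotes isomorphism (as groups, equivalently as rings with these structures). "Boolean ring" means a nontrivial ring in which $x^2=x$ for all $x$ (in the finite case: isomorphic to a direct sum of $r\ge 1$ copies of $\mathbb{Z}_2$). *)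

theory Defs
  imports "HOL-Algebra.Algebra"
begin

definition cyclic_sum :: "nat list \<Rightarrow> int set list ring" where
  "cyclic_sum ns = RDirProd_list (map (\<lambda>n. ZFact (int n)) ns)"

text \<open>
  The carrier of a ring structure on \<open>U(R)\<close> is the set of units of \<open>R\<close>, and its addition is the
  multiplication of \<open>R\<close>; the multiplication is transported along a group isomorphism \<open>f\<close> from the
  additive group of a direct sum of rings \<open>\<int>/n\<close> with \<open>n \<ge> 1\<close>. Positivity is needed because
  \<^term>\<open>ZFact 0\<close> is the ring of integers. The list \<open>ns\<close> may be empty, giving the zero ring.
\<close>

definition is_unit_ring :: "('a, 'b) ring_scheme \<Rightarrow> 'a ring \<Rightarrow> bool" where
  "is_unit_ring R S \<longleftrightarrow>
     (\<exists>ns f. (\<forall>n\<in>set ns. n \<ge> 1) \<and>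
             f \<in> iso (add_monoid (cyclic_sum ns)) (units_of R) \<and>
             S = image_ring f (cyclic_sum ns))"

text \<open>
  For a finite commutative ring all candidates are isomorphic as rings, so the choice of \<open>S\<close> is
  immaterial up to ring isomorphism.
\<close>

definition unit_ring :: "('a, 'b) ring_scheme \<Rightarrow> 'a ring" where
  "unit_ring R = (SOME S. is_unit_ring R S)"

primrec iterated_unit_ring :: "nat \<Rightarrow> 'a ring \<Rightarrow> 'a ring" where
  "iterated_unit_ring 0 R = R"
| "iterated_unit_ring (Suc k) R = unit_ring (iterated_unit_ring k R)"

definition boolean_ring :: "('a, 'b) ring_scheme \<Rightarrow> bool" where
  "boolean_ring R \<longleftrightarrow>
     ring R \<and> \<one>\<^bsub>R\<^esub> \<noteq> \<zero>\<^bsub>R\<^esub> \<and> (\<forall>x\<in>carrier R. x \<otimes>\<^bsub>R\<^esub> x = x)"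

end

theory Submission
  imports Defs "HOL-Number_Theory.Residue_Primitive_Roots"
begin

text \<open>
  Write \<open>X(k,a)\<close> for the \<open>k\<close>-th group of units of \<open>\<int>/p\<^sup>a\<close> and \<open>V(k) = X(k,1)\<close>. As \<open>p\<close> is odd, the
  units modulo \<open>p\<^sup>a\<^sup>+\<^sup>1\<close> form a cyclic group of order \<open>p\<^sup>a (p - 1)\<close>, which by the Chinese remainder
  theorem carries the ring structure \<open>\<int>/p\<^sup>a \<times> \<int>/(p - 1)\<close>, and \<open>\<int>/(p - 1)\<close> is \<open>V(1)\<close>. Taking units
  commutes with direct products, hence \<open>X(k+1,a+1) \<simeq> X(k,a) \<times> V(k+1)\<close>
  (\<open>iterated_unit_ring_prime_power\<close>).

  Call a ring idempotent if \<open>x\<^sup>2 = x\<close> throughout; a boolean ring is a nontrivial idempotent one. A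
  product is idempotent exactly if both factors are, and the only unit of an idempotent ring is \<open>1\<close>,
  so that all later groups of units vanish. Following the recursion down to \<open>a = 1\<close>, an idempotent
  \<open>X(k,a)\<close> forces \<open>V(k-a+1)\<close> to be idempotent, and \<open>k > a\<close>: otherwise one of \<open>\<int>/p\<^sup>i\<close> with \<open>i \<ge> 1\<close> or
  \<open>\<int>/(p - 1)\<close> would be idempotent, whereas \<open>\<int>/n\<close> with \<open>n > 2\<close> never is; this is where \<open>p \<noteq> 3\<close>
  enters. Conversely, if \<open>k > a\<close> and \<open>V(k-a+1)\<close> is idempotent, then \<open>V(k-a+2), \<dots>, V(k)\<close> are all
  trivial and the recursion collapses to \<open>X(k,a) \<simeq> V(k-a+1)\<close>. The theorem follows, since
  isomorphisms preserve and reflect being boolean.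

  All of this takes place up to isomorphism, whereas the ring of units is an arbitrary choice among
  ring structures that come from decompositions into cyclic groups. Two classical facts make the
  choice harmless. First, a decomposition exists for every finite abelian group
  (\<open>finite_abelian_group_decomposition\<close>). Secondly, two direct sums of rings \<open>\<int>/n\<close> with isomorphic
  additive groups are isomorphic as rings (\<open>cyclic_type_unique\<close>): the number of elements killed by
  \<open>m\<close> is the product of the \<open>gcd(m, n\<^sub>i)\<close>, and these products determine the ring.
\<close>

section \<open>Isomorphisms and direct products of rings\<close>

declare ring_iso_trans [trans]

lemma is_ring_iso_add: "R \<simeq> S \<Longrightarrow> add_monoid R \<cong> add_monoid S"
  unfolding is_ring_iso_def is_iso_def ring_iso_def ring_hom_def iso_def hom_def by auto

text \<open>
  The equations \<open>x y = 1\<close> and \<open>y x = 1\<close> that make \<open>x\<close> a unit are preserved by an isomorphism, and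
  reflected because it is injective.
\<close>
lemma is_ring_iso_units:
  assumes "ring R" "ring S" "R \<simeq> S"
  shows "units_of R \<cong> units_of S"
proof -
  interpret R: ring R by fact
  interpret S: ring S by fact
  obtain h where h: "h \<in> ring_iso R S" using assms unfolding is_ring_iso_def by auto
  note hE = ring_iso_memE[OF h]
  have inj: "inj_on h (carrier R)" and img: "h ` carrier R = carrier S"
    using hE(5) by (auto simp: bij_betw_def)
  have "h x \<in> Units S \<longleftrightarrow> x \<in> Units R" if x: "x \<in> carrier R" for x
  proof -
    have eq: "h x \<otimes>\<^bsub>S\<^esub> h y = \<one>\<^bsub>S\<^esub> \<longleftrightarrow> x \<otimes>\<^bsub>R\<^esub> y = \<one>\<^bsub>R\<^esub>"
             "h y \<otimes>\<^bsub>S\<^esub> h x = \<one>\<^bsub>S\<^esub> \<longleftrightarrow> y \<otimes>\<^bsub>R\<^esub> x = \<one>\<^bsub>R\<^esub>" if "y \<in> carrier R" for y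
      using that x hE(2)[of x y] hE(2)[of y x] hE(4) inj
      by (metis R.m_closed R.one_closed inj_onD)+
    show ?thesis
      unfolding Units_def img[symmetric] using x eq by auto
  qed
  then have "h ` Units R = Units S"
    using img R.Units_closed S.Units_closed by (auto simp: image_iff) (metis imageE)
  then have "h \<in> iso (units_of R) (units_of S)"
    unfolding iso_def hom_def bij_betw_def units_of_def
    using hE(2) inj R.Units_closed by (auto intro: inj_on_subset)
  then show ?thesis by (rule is_isoI)
qed

lemma Units_RDirProd:
  assumes "ring R" "ring S"
  shows "Units (RDirProd R S) = Units R \<times> Units S"
  unfolding Units_def RDirProd_def DirProd_def
  by (auto simp: monoid.defs)

lemma units_of_RDirProd:
  assumes "ring R" "ring S"
  shows "units_of (RDirProd R S) \<cong> units_of R \<times>\<times> units_of S"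
proof -
  have "id \<in> iso (units_of (RDirProd R S)) (units_of R \<times>\<times> units_of S)"
    unfolding iso_def hom_def using assms
    by (auto simp: units_of_def Units_RDirProd) (auto simp: RDirProd_def DirProd_def monoid.defs)
  then show ?thesis by (rule is_isoI)
qed

lemma RDirProd_cong: "R \<simeq> R' \<Longrightarrow> S \<simeq> S' \<Longrightarrow> RDirProd R S \<simeq> RDirProd R' S'"
  unfolding is_ring_iso_def using RDirProd_iso6 by blast

section \<open>Residue rings of the integers\<close>

lemma ZMod_in_ZFact [simp]: "ZMod n a \<in> carrier (ZFact n)"
  unfolding ZMod_def ZFact_def FactRing_def A_RCOSETS_def' by auto

lemma carrier_ZFact: "carrier (ZFact n) = range (ZMod n)"
  unfolding ZMod_def ZFact_def FactRing_def A_RCOSETS_def' by auto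

lemma ZMod_hom: "ZMod n \<in> ring_hom \<Z> (ZFact n)"
  unfolding ZFact_def ZMod_def[abs_def]
  by (rule ideal.rcos_ring_hom) (simp add: int.genideal_ideal)

lemma ZMod_add [simp]: "ZMod n a \<oplus>\<^bsub>ZFact n\<^esub> ZMod n b = ZMod n (a + b)"
  using ring_hom_add[OF ZMod_hom, of a b n] by simp

lemma ZMod_mult [simp]: "ZMod n a \<otimes>\<^bsub>ZFact n\<^esub> ZMod n b = ZMod n (a * b)"
  using ring_hom_mult[OF ZMod_hom, of a b n] by simp

lemma ZMod_one: "\<one>\<^bsub>ZFact n\<^esub> = ZMod n 1"
  using ring_hom_one[OF ZMod_hom, of n] by simp

lemma ZMod_zero: "\<zero>\<^bsub>ZFact n\<^esub> = ZMod n 0"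
  using ring_hom_zero[OF ZMod_hom int.ring_axioms] ZFact_is_cring by (simp add: cring_def)

lemma ZMod_eq_iff: "ZMod n a = ZMod n b \<longleftrightarrow> n dvd a - b"
  by (simp add: ZMod_eq_mod mod_eq_dvd_iff)

lemma ring_ZFact: "ring (ZFact n)"
  using ZFact_is_cring cring_def by blast

lemma ZFact_image: "n > 0 \<Longrightarrow> carrier (ZFact n) = ZMod n ` {0..<n}"
  unfolding carrier_ZFact using ZMod_mod[of n] by (auto simp: image_iff) (metis atLeastLessThan_iff pos_mod_bound pos_mod_sign)

lemma inj_on_ZMod: "inj_on (ZMod n) {0..<n}"
  by (auto intro!: inj_onI simp: ZMod_eq_mod)

lemma finite_ZFact: "n > 0 \<Longrightarrow> finite (carrier (ZFact n))"
  by (simp add: ZFact_image)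

text \<open>
  The Chinese remainder theorem: the ideals of multiples of \<open>a\<close> and of \<open>b\<close> meet in the multiples of
  \<open>a b\<close>, and by Bezout they add up to \<open>\<int>\<close>.
\<close>
lemma ZFact_mult_coprime:
  assumes "coprime a b"
  shows "ZFact (a * b) \<simeq> RDirProd (ZFact a) (ZFact b)"
proof -
  let ?I = "\<lambda>k. Idl\<^bsub>\<Z>\<^esub> {k::int}"
  have id: "ideal (?I k) \<Z>" for k by (simp add: int.genideal_ideal)
  have "?I a \<inter> ?I b = ?I (a * b)"
  proof -
    have "x \<in> ?I k \<longleftrightarrow> k dvd x" for x k :: int by (auto simp: int_Idl dvd_def mult.commute)
    then show ?thesis using divides_mult[OF _ _ assms] by (auto dest: dvd_mult_left dvd_mult_right)
  qed
  moreover have "?I a <+>\<^bsub>\<Z>\<^esub> ?I b = carrier \<Z>"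
  proof -
    obtain u v where uv: "u * a + v * b = 1" using assms bezout_int[of a b] by auto
    have "x \<in> ?I a <+>\<^bsub>\<Z>\<^esub> ?I b" for x
    proof -
      have "x = (x * u) * a + (x * v) * b" using uv by (metis distrib_left mult.assoc mult.right_neutral)
      then show ?thesis unfolding set_add_def' int_Idl by auto
    qed
    then show ?thesis by auto
  qed
  ultimately show ?thesis
    using ring.chinese_remainder_simple[OF int.ring_axioms id id] by (metis ZFact_def)
qed

section \<open>Direct sums of residue rings\<close>

lemma cyclic_sum_Cons: "RDirProd (ZFact (int n)) (cyclic_sum ns) \<simeq> cyclic_sum (n # ns)"
  unfolding cyclic_sum_def is_ring_iso_def using RDirProd_list_iso1 by fastforce

lemma ring_cyclic_sum: "ring (cyclic_sum ns)"
  unfolding cyclic_sum_def by (intro RDirProd_list_is_ring) (simp add: ring_ZFact)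

lemma cyclic_sum_Cons_sym: "cyclic_sum (n # ns) \<simeq> RDirProd (ZFact (int n)) (cyclic_sum ns)"
  by (intro ring_iso_sym[OF _ cyclic_sum_Cons] RDirProd_ring ring_ZFact ring_cyclic_sum)

lemma cyclic_sum_single: "ZFact (int n) \<simeq> cyclic_sum [n]"
  unfolding cyclic_sum_def is_ring_iso_def using RDirProd_list_iso3 by fastforce

lemma RDirProd_comm: "RDirProd R S \<simeq> RDirProd S R"
  unfolding is_ring_iso_def using RDirProd_iso1 by blast

lemma RDirProd_assoc: "RDirProd (RDirProd R S) T \<simeq> RDirProd R (RDirProd S T)"
  unfolding is_ring_iso_def using RDirProd_iso3 by blast

lemma RDirProd_assoc_sym: "RDirProd R (RDirProd S T) \<simeq> RDirProd (RDirProd R S) T"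
  unfolding is_ring_iso_def using RDirProd_iso2 by blast

lemma RDirProd_left_comm: "RDirProd R (RDirProd S T) \<simeq> RDirProd S (RDirProd R T)"
  by (rule ring_iso_trans[OF RDirProd_assoc_sym ring_iso_trans[OF RDirProd_cong[OF RDirProd_comm ring_iso_refl] RDirProd_assoc]])

text \<open>
  In a ring with one element \<open>1 = 0\<close>, so that \<open>r \<mapsto> (r, 0)\<close> is unital.
\<close>
lemma RDirProd_trivial:
  assumes "ring R" "ring S" "carrier S = {\<zero>\<^bsub>S\<^esub>}"
  shows "R \<simeq> RDirProd R S"
proof -
  interpret S: ring S by fact
  have "\<one>\<^bsub>S\<^esub> = \<zero>\<^bsub>S\<^esub>" using assms(3) S.one_closed by auto
  then have "(\<lambda>r. (r, \<zero>\<^bsub>S\<^esub>)) \<in> ring_iso R (RDirProd R S)"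
    using assms(3) unfolding ring_iso_def ring_hom_def bij_betw_def inj_on_def
    by (auto simp: RDirProd_def DirProd_def monoid.defs)
  then show ?thesis by (auto simp: is_ring_iso_def)
qed

lemma cyclic_sum_append: "RDirProd (cyclic_sum ns) (cyclic_sum ms) \<simeq> cyclic_sum (ns @ ms)"
proof (induction ns)
  case Nil
  have "RDirProd (cyclic_sum ms) (cyclic_sum []) \<simeq> cyclic_sum ms"
    using ring_cyclic_sum ring_cyclic_sum[of "[]"]
    by (intro ring_iso_sym[OF _ RDirProd_trivial]) (auto simp: cyclic_sum_def monoid.defs)
  then show ?case using RDirProd_comm ring_iso_trans by fastforce
next
  case (Cons n ns)
  have "RDirProd (cyclic_sum (n # ns)) (cyclic_sum ms) \<simeq>
        RDirProd (RDirProd (ZFact (int n)) (cyclic_sum ns)) (cyclic_sum ms)"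
    by (intro RDirProd_cong cyclic_sum_Cons_sym ring_iso_refl)
  also have "\<dots> \<simeq> RDirProd (ZFact (int n)) (RDirProd (cyclic_sum ns) (cyclic_sum ms))"
    by (rule RDirProd_assoc)
  also have "\<dots> \<simeq> RDirProd (ZFact (int n)) (cyclic_sum (ns @ ms))"
    by (intro RDirProd_cong Cons ring_iso_refl)
  also have "\<dots> \<simeq> cyclic_sum ((n # ns) @ ms)"
    using cyclic_sum_Cons by simp
  finally show ?case .
qed

text \<open>
  This makes the order of the summands irrelevant up to isomorphism.
\<close>
lemma cyclic_sum_extract:
  "cyclic_sum (us @ n # vs) \<simeq> RDirProd (ZFact (int n)) (cyclic_sum (us @ vs))"
proof (induction us)
  case Nil
  then show ?case using cyclic_sum_Cons_sym by simp
next
  case (Cons u us)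
  have "cyclic_sum ((u # us) @ n # vs) \<simeq> RDirProd (ZFact (int u)) (cyclic_sum (us @ n # vs))"
    using cyclic_sum_Cons_sym by simp
  also have "\<dots> \<simeq> RDirProd (ZFact (int u)) (RDirProd (ZFact (int n)) (cyclic_sum (us @ vs)))"
    by (intro RDirProd_cong Cons ring_iso_refl)
  also have "\<dots> \<simeq> RDirProd (ZFact (int n)) (RDirProd (ZFact (int u)) (cyclic_sum (us @ vs)))"
    by (rule RDirProd_left_comm)
  also have "\<dots> \<simeq> RDirProd (ZFact (int n)) (cyclic_sum ((u # us) @ vs))"
    using cyclic_sum_Cons by (intro RDirProd_cong ring_iso_refl) simp
  finally show ?case .
qed

lemma cring_iso:
  assumes "cring R" "ring S" "R \<simeq> S"
  shows "cring S"
proof -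
  obtain h where h: "h \<in> ring_iso R S" using assms unfolding is_ring_iso_def by auto
  interpret R: cring R by fact
  interpret S: ring S by fact
  have img: "carrier S = h ` carrier R"
    using ring_iso_memE(5)[OF h] by (simp add: bij_betw_def)
  show ?thesis
    by (intro cring.intro S.ring_axioms comm_monoid.intro S.monoid_axioms comm_monoid_axioms.intro)
      (auto simp: img R.m_comm simp flip: ring_iso_memE(2)[OF h])
qed

lemma cring_RDirProd: "cring R \<Longrightarrow> cring S \<Longrightarrow> cring (RDirProd R S)"
  by (intro cring.intro RDirProd_ring comm_monoid.intro comm_monoid_axioms.intro ring.is_monoid)
     (auto simp: cring_def RDirProd_ring,
      auto simp: RDirProd_def DirProd_def monoid.defs comm_monoid.m_comm)

lemma cring_cyclic_sum: "cring (cyclic_sum ns)"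
proof (induction ns)
  case Nil
  show ?case
    using ring_cyclic_sum[of "[]"]
    by (intro cring.intro comm_monoid.intro comm_monoid_axioms.intro ring.is_monoid)
      (auto simp: cyclic_sum_def monoid.defs)
next
  case (Cons n ns)
  show ?case
    by (rule cring_iso[OF cring_RDirProd[OF ZFact_is_cring Cons] ring_cyclic_sum cyclic_sum_Cons])
qed

lemma finite_cyclic_sum: "\<forall>n\<in>set ns. n \<ge> 1 \<Longrightarrow> finite (carrier (cyclic_sum ns))"
proof (induction ns)
  case Nil
  then show ?case by (simp add: cyclic_sum_def)
next
  case (Cons n ns)
  then show ?case
    using finite_ZFact[of "int n"] by (simp add: cyclic_sum_def RDirProd_list_carrier)
qed

lemma cyclic_sum_add_Cons:
  assumes "a \<in> carrier (ZFact (int n))" "b \<in> carrier (ZFact (int n))"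
    "as \<in> carrier (cyclic_sum ns)" "bs \<in> carrier (cyclic_sum ns)"
  shows "(a # as) \<oplus>\<^bsub>cyclic_sum (n # ns)\<^esub> (b # bs) = (a \<oplus>\<^bsub>ZFact (int n)\<^esub> b) # (as \<oplus>\<^bsub>cyclic_sum ns\<^esub> bs)"
  using ring_hom_add[OF RDirProd_list_hom1, of "(a, as)" "ZFact (int n)" "map (\<lambda>n. ZFact (int n)) ns" "(b, bs)"] assms
  by (simp add: cyclic_sum_def RDirProd_carrier) (simp add: RDirProd_def DirProd_def monoid.defs)

lemma nth_cyclic_sum_add:
  assumes "L \<in> carrier (cyclic_sum ns)" "M \<in> carrier (cyclic_sum ns)" "i < length ns"
  shows "(L \<oplus>\<^bsub>cyclic_sum ns\<^esub> M) ! i = L ! i \<oplus>\<^bsub>ZFact (int (ns ! i))\<^esub> M ! i"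
  using assms
proof (induction ns arbitrary: L M i)
  case (Cons n ns)
  then obtain a as b bs where [simp]: "L = a # as" "M = b # bs"
    and ab: "a \<in> carrier (ZFact (int n))" "b \<in> carrier (ZFact (int n))"
      "as \<in> carrier (cyclic_sum ns)" "bs \<in> carrier (cyclic_sum ns)"
    by (auto simp: cyclic_sum_def RDirProd_list_carrier)
  show ?case
    using Cons.IH[OF ab(3,4)] Cons.prems(3) by (cases i) (simp_all add: cyclic_sum_add_Cons ab)
qed simp

lemma cyclic_sum_carrier_iff:
  "L \<in> carrier (cyclic_sum ns) \<longleftrightarrow>
     length L = length ns \<and> (\<forall>i<length ns. L ! i \<in> carrier (ZFact (int (ns ! i))))"
  unfolding cyclic_sum_def
  using RDirProd_list_carrier_mem[of L "map (\<lambda>n. ZFact (int n)) ns"]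
    RDirProd_list_carrier_memI[of L "map (\<lambda>n. ZFact (int n)) ns"] by auto

section \<open>Bases of finite abelian groups\<close>

context comm_group begin

text \<open>
  Linear algebra over \<open>\<int>\<close>, with the module written as a multiplicative group.
\<close>
definition lin_comb :: "('i \<Rightarrow> 'a) \<Rightarrow> ('i \<Rightarrow> int) \<Rightarrow> 'i set \<Rightarrow> 'a" where
  "lin_comb x c I = (\<Otimes>i\<in>I. x i [^] c i)"

definition lin_span :: "('i \<Rightarrow> 'a) \<Rightarrow> 'i set \<Rightarrow> 'a set" where
  "lin_span x I = range (\<lambda>c. lin_comb x c I)"

lemma lin_comb_closed [simp]: "x \<in> I \<rightarrow> carrier G \<Longrightarrow> lin_comb x c I \<in> carrier G"
  unfolding lin_comb_def by (intro finprod_closed) auto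

lemma lin_comb_cong:
  assumes "y \<in> I \<rightarrow> carrier G" "\<And>i. i \<in> I \<Longrightarrow> x i = y i" "\<And>i. i \<in> I \<Longrightarrow> c i = d i"
  shows "lin_comb x c I = lin_comb y d I"
  unfolding lin_comb_def by (intro finprod_cong') (use assms in auto)

lemma lin_comb_remove:
  assumes "finite I" "i \<in> I" "x \<in> I \<rightarrow> carrier G"
  shows "lin_comb x c I = x i [^] c i \<otimes> lin_comb x c (I - {i})"
proof -
  have "lin_comb x c (insert i (I - {i})) = x i [^] c i \<otimes> lin_comb x c (I - {i})"
    unfolding lin_comb_def using assms by (intro finprod_insert) auto
  then show ?thesis
    using assms(2) by (simp add: insert_absorb)
qed

lemma lin_comb_add:
  assumes "x \<in> I \<rightarrow> carrier G"
  shows "lin_comb x (\<lambda>i. c i + d i) I = lin_comb x c I \<otimes> lin_comb x d I"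
proof -
  have "lin_comb x (\<lambda>i. c i + d i) I = (\<Otimes>i\<in>I. x i [^] c i \<otimes> x i [^] d i)"
    unfolding lin_comb_def using assms by (intro finprod_cong') (auto simp: int_pow_mult Pi_iff)
  also have "\<dots> = lin_comb x c I \<otimes> lin_comb x d I"
    unfolding lin_comb_def by (intro finprod_multf) (use assms in auto)
  finally show ?thesis .
qed

lemma lin_comb_eq_one: "(\<And>i. i \<in> I \<Longrightarrow> x i [^] c i = \<one>) \<Longrightarrow> lin_comb x c I = \<one>"
  unfolding lin_comb_def by (intro finprod_one_eqI) auto

lemma lin_comb_mult:
  assumes "finite I" "x \<in> I \<rightarrow> carrier G"
  shows "lin_comb x (\<lambda>i. c i * k) I = lin_comb x c I [^] (k::int)"
  using assms
proof (induction I rule: finite_induct)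
  case empty
  then show ?case by (simp add: lin_comb_def)
next
  case (insert i I)
  then have "lin_comb x c (insert i I) = x i [^] c i \<otimes> lin_comb x c I" for c
    by (subst lin_comb_remove[of _ i]) auto
  with insert show ?case
    by (simp add: int_pow_distrib int_pow_pow Pi_iff)
qed

lemma lin_comb_single:
  assumes "finite I" "i \<in> I" "x \<in> I \<rightarrow> carrier G"
  shows "lin_comb x (\<lambda>j. if j = i then k else 0) I = x i [^] k"
proof -
  have "lin_comb x (\<lambda>j. if j = i then k else 0) (I - {i}) = \<one>"
    by (rule lin_comb_eq_one) auto
  then show ?thesis
    using assms by (subst lin_comb_remove[of I i]) (auto simp: Pi_iff)
qed

text \<open>
  An elementary operation on generators: adding a combination of the other generators to \<open>x\<^sub>i\<close> (the
  others, as \<open>e\<^sub>i = 0\<close>) amounts to a shear of the coefficients. The inverse shear shows that the span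
  does not change, which is \<open>lin_span_shear\<close>.
\<close>
lemma lin_comb_shear:
  assumes "finite I" "i \<in> I" "x \<in> I \<rightarrow> carrier G" "e i = 0"
  shows "lin_comb (x(i := x i \<otimes> lin_comb x e I)) c I = lin_comb x (\<lambda>j. c j + e j * c i) I"
proof -
  have xi: "x i \<in> carrier G" using assms by auto
  have "lin_comb (x(i := x i \<otimes> lin_comb x e I)) c I
      = (x i \<otimes> lin_comb x e I) [^] c i \<otimes> lin_comb (x(i := x i \<otimes> lin_comb x e I)) c (I - {i})"
    using assms by (subst lin_comb_remove[of I i]) (auto simp: Pi_iff)
  also have "lin_comb (x(i := x i \<otimes> lin_comb x e I)) c (I - {i}) = lin_comb x c (I - {i})"
    using assms by (intro lin_comb_cong) auto
  also have "(x i \<otimes> lin_comb x e I) [^] c i = x i [^] c i \<otimes> lin_comb x (\<lambda>j. e j * c i) I"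
    using assms xi by (simp add: int_pow_distrib lin_comb_mult)
  also have "x i [^] c i \<otimes> lin_comb x (\<lambda>j. e j * c i) I \<otimes> lin_comb x c (I - {i})
     = (x i [^] c i \<otimes> lin_comb x c (I - {i})) \<otimes> lin_comb x (\<lambda>j. e j * c i) I"
    using assms xi by (simp add: m_ac Pi_iff)
  also have "x i [^] c i \<otimes> lin_comb x c (I - {i}) = lin_comb x c I"
    using assms lin_comb_remove by metis
  also have "lin_comb x c I \<otimes> lin_comb x (\<lambda>j. e j * c i) I = lin_comb x (\<lambda>j. c j + e j * c i) I"
    using assms by (simp add: lin_comb_add)
  finally show ?thesis .
qed

lemma lin_span_shear:
  assumes "finite I" "i \<in> I" "x \<in> I \<rightarrow> carrier G" "e i = 0"
  shows "lin_span (x(i := x i \<otimes> lin_comb x e I)) I = lin_span x I"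
proof (intro equalityI subsetI)
  fix g assume "g \<in> lin_span (x(i := x i \<otimes> lin_comb x e I)) I"
  then show "g \<in> lin_span x I"
    unfolding lin_span_def using lin_comb_shear[where e=e, OF assms] by auto
next
  fix g assume "g \<in> lin_span x I"
  then obtain c where g: "g = lin_comb x c I" unfolding lin_span_def by auto
  have "lin_comb (x(i := x i \<otimes> lin_comb x e I)) (\<lambda>j. c j - e j * c i) I
      = lin_comb x (\<lambda>j. (c j - e j * c i) + e j * (c i - e i * c i)) I"
    by (rule lin_comb_shear[where e=e, OF assms])
  also have "\<dots> = g" using assms by (simp add: g)
  finally show "g \<in> lin_span (x(i := x i \<otimes> lin_comb x e I)) I"
    unfolding lin_span_def by (intro image_eqI[of _ _ "\<lambda>j. c j - e j * c i"]) auto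
qed

text \<open>
  Among all relations between all families \<open>I \<rightarrow> G\<close> with the given span, let \<open>d\<close> be the least
  positive coefficient, say of \<open>y\<^sub>i\<close> in a relation with coefficients \<open>c\<close>. Adding to \<open>y\<^sub>i\<close> the
  combination of the other members with coefficients \<open>c\<^sub>j div d\<close> is a shear that replaces every other
  \<open>c\<^sub>j\<close> by its remainder modulo \<open>d\<close>, which has to vanish by minimality; the new \<open>i\<close>-th generator
  \<open>z\<^sub>i\<close> therefore satisfies \<open>z\<^sub>i\<^sup>d = 1\<close>. In any relation between the new generators, subtracting a
  multiple of this one reduces the \<open>i\<close>-th coefficient modulo \<open>d\<close>,
  so minimality makes it divisible by \<open>d\<close>. Thus the cyclic group generated by \<open>z\<^sub>i\<close> meets the span of
  the other generators trivially.
\<close>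
lemma ex_splitting_generator:
  assumes "finite (carrier G)" "finite I" "I \<noteq> {}" "x \<in> I \<rightarrow> carrier G"
  shows "\<exists>i y d. i \<in> I \<and> y \<in> I \<rightarrow> carrier G \<and> lin_span y I = lin_span x I \<and> (0::nat) < d \<and>
           (y i [^] int d = \<one>) \<and> (\<forall>c. lin_comb y c I = \<one> \<longrightarrow> int d dvd c i)"
proof -
  define P where "P d \<longleftrightarrow> 0 < d \<and> (\<exists>y c i. i \<in> I \<and> y \<in> I \<rightarrow> carrier G \<and>
      lin_span y I = lin_span x I \<and> lin_comb y c I = \<one> \<and> c i = int d)" for d :: nat
  \<comment> \<open>Some positive coefficient occurs: every element satisfies \<open>x\<^sup>n = 1\<close> for \<open>n\<close> the group order.\<close>
  obtain j where j: "j \<in> I" using assms by auto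
  have "P (order G)"
  proof -
    have "x j [^] int (order G) = \<one>"
      using j assms by (subst int_pow_int, subst pow_order_eq_1) auto
    then have "lin_comb x (\<lambda>i. if i = j then int (order G) else 0) I = \<one>"
      using j assms lin_comb_single by metis
    then show ?thesis
      unfolding P_def using j assms order_gt_0_iff_finite
      by (intro conjI exI[of _ x] exI[of _ "\<lambda>i. if i = j then int (order G) else 0"] exI[of _ j]) auto
  qed
  define d where "d = (LEAST d. P d)"
  have Pd: "P d" unfolding d_def using \<open>P (order G)\<close> by (rule LeastI)
  have least: "d \<le> d'" if "P d'" for d' unfolding d_def using that by (rule Least_le)
  obtain y c i where i: "i \<in> I" and y: "y \<in> I \<rightarrow> carrier G" "lin_span y I = lin_span x I"
    and c: "lin_comb y c I = \<one>" "c i = int d" and d: "0 < d"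
    using Pd unfolding P_def by auto
  \<comment> \<open>The quotients of the \<open>c j\<close> by \<open>d\<close>, so that the shear leaves the remainders.\<close>
  define e where "e j = (if j = i then 0 else c j div int d)" for j
  define z where "z = y(i := y i \<otimes> lin_comb y e I)"
  have ei: "e i = 0" by (simp add: e_def)
  have z: "z \<in> I \<rightarrow> carrier G"
    using y i by (auto simp: z_def Pi_iff)
  have span_z: "lin_span z I = lin_span x I"
    unfolding z_def using lin_span_shear[where e=e, OF assms(2) i y(1) ei] y(2) by simp
  have small: "c' j = 0" if "lin_comb z c' I = \<one>" "j \<in> I" "0 \<le> c' j" "c' j < int d" for c' j
  proof (rule ccontr)
    assume "c' j \<noteq> 0"
    then have "P (nat (c' j))"
      unfolding P_def using that z span_z by (intro conjI exI[of _ z] exI[of _ c'] exI[of _ j]) auto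
    from least[OF this] that show False by linarith
  qed
  have "lin_comb z (\<lambda>j. c j - e j * c i) I
      = lin_comb y (\<lambda>j. (c j - e j * c i) + e j * (c i - e i * c i)) I"
    unfolding z_def by (rule lin_comb_shear[where e=e, OF assms(2) i y(1) ei])
  also have "\<dots> = \<one>" using c ei by simp
  finally have rel: "lin_comb z (\<lambda>j. c j - e j * c i) I = \<one>" .
  have "c j - e j * c i = 0" if "j \<in> I" "j \<noteq> i" for j
  proof (rule small[OF rel \<open>j \<in> I\<close>])
    have "c j - e j * c i = c j mod int d"
      using that c by (simp add: e_def minus_div_mult_eq_mod)
    then show "0 \<le> c j - e j * c i" "c j - e j * c i < int d"
      using d by auto
  qed
  then have "lin_comb z (\<lambda>j. c j - e j * c i) I = lin_comb z (\<lambda>j. if j = i then int d else 0) I"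
    using z c ei by (intro lin_comb_cong) auto
  then have zd: "z i [^] int d = \<one>"
    using rel lin_comb_single[OF assms(2) i z] by metis
  have "int d dvd c' i" if c': "lin_comb z c' I = \<one>" for c'
  proof -
    define f where "f j = (if j = i then - int d * (c' i div int d) else 0)" for j
    have zi: "z i \<in> carrier G" using z i by auto
    have "lin_comb z f I = z i [^] (- int d * (c' i div int d))"
      unfolding f_def by (rule lin_comb_single[OF assms(2) i z])
    also have "\<dots> = \<one>"
      using zi zd by (metis int_pow_pow int_pow_one int_pow_neg inv_one)
    finally have "lin_comb z (\<lambda>j. c' j + f j) I = \<one>"
      using lin_comb_add[OF z] c' by simp
    moreover have "c' i + f i = c' i mod int d"
      by (simp add: f_def minus_mult_div_eq_mod)
    ultimately have "c' i mod int d = 0"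
      using small[of "\<lambda>j. c' j + f j" i] i d by simp
    then show ?thesis by auto
  qed
  with i z span_z d zd show ?thesis by (intro exI[of _ i] exI[of _ z] exI[of _ d]) simp
qed

text \<open>
  Split off one cyclic factor at a time. The condition on \<open>n\<close> says that \<open>y\<close> is independent with
  orders \<open>n\<close>: only the obvious relations hold.
\<close>
lemma ex_basis:
  assumes "finite (carrier G)" "finite I" "x \<in> I \<rightarrow> carrier G"
  shows "\<exists>y n. y \<in> I \<rightarrow> carrier G \<and> lin_span y I = lin_span x I \<and> (\<forall>i\<in>I. (0::nat) < n i) \<and>
           (\<forall>c. lin_comb y c I = \<one> \<longleftrightarrow> (\<forall>i\<in>I. int (n i) dvd c i))"
  using assms(2,3)
proof (induction "card I" arbitrary: I x)
  case 0
  then show ?case by (auto simp: lin_comb_def)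
next
  case (Suc k)
  then have "I \<noteq> {}" by auto
  with ex_splitting_generator[OF assms(1) Suc.prems(1) _ Suc.prems(2)]
  obtain i z d where i: "i \<in> I" and z: "z \<in> I \<rightarrow> carrier G" "lin_span z I = lin_span x I"
    and d: "(0::nat) < d" "z i [^] int d = \<one>"
    and piv: "\<And>c. lin_comb z c I = \<one> \<Longrightarrow> int d dvd c i"
    by blast
  let ?J = "I - {i}"
  have zi: "z i \<in> carrier G" using i z by auto
  have "\<exists>y n. y \<in> ?J \<rightarrow> carrier G \<and> lin_span y ?J = lin_span z ?J \<and> (\<forall>j\<in>?J. (0::nat) < n j) \<and>
           (\<forall>c. lin_comb y c ?J = \<one> \<longleftrightarrow> (\<forall>j\<in>?J. int (n j) dvd c j))"
    using Suc i z by (intro Suc.hyps) auto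
  then obtain y n where y: "y \<in> ?J \<rightarrow> carrier G" "lin_span y ?J = lin_span z ?J"
    and n: "\<And>j. j \<in> ?J \<Longrightarrow> (0::nat) < n j"
    and ind: "\<And>c. lin_comb y c ?J = \<one> \<longleftrightarrow> (\<forall>j\<in>?J. int (n j) dvd c j)"
    by blast
  define w where "w = y(i := z i)"
  define m where "m = n(i := d)"
  have w: "w \<in> I \<rightarrow> carrier G" using y zi by (auto simp: w_def Pi_iff)
  have w_comb: "lin_comb w c I = z i [^] c i \<otimes> lin_comb y c ?J" for c
  proof -
    have "lin_comb w c ?J = lin_comb y c ?J"
      using y by (intro lin_comb_cong) (auto simp: w_def)
    then show ?thesis
      using lin_comb_remove[OF Suc.prems(1) i w, of c] by (simp add: w_def)
  qed
  have z': "z \<in> ?J \<rightarrow> carrier G" using z by auto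
  note z_comb = lin_comb_remove[OF Suc.prems(1) i z(1)]
  have upd: "lin_comb v (c(i := k)) ?J = lin_comb v c ?J" if "v \<in> ?J \<rightarrow> carrier G" for v c k
    using that by (intro lin_comb_cong) auto
  \<comment> \<open>The parts over \<open>I - {i}\<close> have the same span, so a combination of \<open>w\<close> is one of \<open>z\<close> with the
    same \<open>i\<close>-th coefficient, and conversely.\<close>
  have wz: "\<exists>c'. c' i = c i \<and> lin_comb z c' I = lin_comb w c I" for c
  proof -
    have "lin_comb y c ?J \<in> lin_span z ?J"
      by (simp add: y(2)[symmetric]) (simp add: lin_span_def)
    then obtain c' where "lin_comb y c ?J = lin_comb z c' ?J"
      unfolding lin_span_def by auto
    then have "lin_comb z (c'(i := c i)) I = lin_comb w c I"
      by (simp add: z_comb w_comb upd z')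
    then show ?thesis by (intro exI[of _ "c'(i := c i)"]) simp
  qed
  have zw: "\<exists>c'. c' i = c i \<and> lin_comb w c' I = lin_comb z c I" for c
  proof -
    have "lin_comb z c ?J \<in> lin_span y ?J"
      by (simp add: y(2)) (simp add: lin_span_def)
    then obtain c' where "lin_comb z c ?J = lin_comb y c' ?J"
      unfolding lin_span_def by auto
    then have "lin_comb w (c'(i := c i)) I = lin_comb z c I"
      by (simp add: z_comb w_comb upd y)
    then show ?thesis by (intro exI[of _ "c'(i := c i)"]) simp
  qed
  have "lin_span w I = lin_span z I"
  proof (intro equalityI subsetI)
    fix g assume "g \<in> lin_span w I"
    then obtain c where "g = lin_comb w c I" unfolding lin_span_def by auto
    moreover obtain c' where "lin_comb w c I = lin_comb z c' I" using wz[of c] by metis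
    ultimately show "g \<in> lin_span z I" unfolding lin_span_def by auto
  next
    fix g assume "g \<in> lin_span z I"
    then obtain c where "g = lin_comb z c I" unfolding lin_span_def by auto
    moreover obtain c' where "lin_comb z c I = lin_comb w c' I" using zw[of c] by metis
    ultimately show "g \<in> lin_span w I" unfolding lin_span_def by auto
  qed
  moreover have "lin_comb w c I = \<one> \<longleftrightarrow> (\<forall>j\<in>I. int (m j) dvd c j)" for c
  proof -
    have zero: "z i [^] c i = \<one>" if "int d dvd c i"
      using that d zi by (metis dvdE int_pow_pow int_pow_one)
    have "int d dvd c i" if "lin_comb w c I = \<one>"
    proof -
      obtain c' where "c' i = c i" "lin_comb z c' I = lin_comb w c I" using wz by blast
      with piv[of c'] that show ?thesis by simp
    qed
    moreover have "lin_comb w c I = lin_comb y c ?J" if "int d dvd c i"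
      using w_comb zero[OF that] y by simp
    ultimately have "lin_comb w c I = \<one> \<longleftrightarrow> int d dvd c i \<and> (\<forall>j\<in>?J. int (n j) dvd c j)"
      using ind by metis
    also have "\<dots> \<longleftrightarrow> (\<forall>j\<in>I. int (m j) dvd c j)"
      using i by (auto simp: m_def)
    finally show ?thesis .
  qed
  moreover have "\<forall>j\<in>I. 0 < m j" using n d by (auto simp: m_def)
  ultimately show ?case using w z(2) by (intro exI[of _ w] exI[of _ m]) simp
qed

end

section \<open>Decomposition of finite abelian groups\<close>

context comm_group begin

lemma lin_comb_eq_iff:
  assumes "y \<in> I \<rightarrow> carrier G"
  shows "lin_comb y c I = lin_comb y d I \<longleftrightarrow> lin_comb y (\<lambda>i. c i - d i) I = \<one>"
proof -
  have "lin_comb y c I = lin_comb y d I \<otimes> lin_comb y (\<lambda>i. c i - d i) I"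
    using lin_comb_add[OF assms, of d "\<lambda>i. c i - d i"] by simp
  then show ?thesis using assms by auto
qed

text \<open>
  A combination of \<open>y\<close> depends only on the residue classes of its coefficients modulo the orders \<open>n\<close>,
  and it determines these classes. So representatives may be chosen arbitrarily.
\<close>
lemma basis_imp_iso:
  assumes y: "y \<in> {..<k} \<rightarrow> carrier G" and span: "lin_span y {..<k} = carrier G"
    and rel: "\<And>c. lin_comb y c {..<k} = \<one> \<longleftrightarrow> (\<forall>i<k. int (n i) dvd c i)"
  shows "add_monoid (cyclic_sum (map n [0..<k])) \<cong> G"
proof -
  let ?C = "cyclic_sum (map n [0..<k])"
  define r where "r L i = (SOME a. L ! i = ZMod (int (n i)) a)" for L i
  define f where "f L = lin_comb y (r L) {..<k}" for L
  have mem: "L \<in> carrier ?C \<longleftrightarrow> length L = k \<and> (\<forall>i<k. L ! i \<in> range (ZMod (int (n i))))" for L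
    by (simp add: cyclic_sum_carrier_iff carrier_ZFact)
  have r: "L ! i = ZMod (int (n i)) (r L i)" if "L \<in> carrier ?C" "i < k" for L i
  proof -
    have "\<exists>a. L ! i = ZMod (int (n i)) a" using that mem by blast
    then show ?thesis unfolding r_def by (rule someI_ex)
  qed
  have eq_iff: "lin_comb y c {..<k} = lin_comb y d {..<k} \<longleftrightarrow> (\<forall>i<k. ZMod (int (n i)) (c i) = ZMod (int (n i)) (d i))"
    for c d
    using rel by (simp add: lin_comb_eq_iff[OF y] ZMod_eq_iff)
  have f_eq: "f L = lin_comb y c {..<k}"
    if "L \<in> carrier ?C" "\<And>i. i < k \<Longrightarrow> L ! i = ZMod (int (n i)) (c i)" for L c
    unfolding f_def eq_iff using that r by metis
  have "f \<in> iso (add_monoid ?C) G"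
  proof (rule isoI)
    show "f \<in> hom (add_monoid ?C) G"
    proof (rule homI)
      fix L M assume "L \<in> carrier (add_monoid ?C)" "M \<in> carrier (add_monoid ?C)"
      then have L: "L \<in> carrier ?C" and M: "M \<in> carrier ?C" by auto
      interpret C: ring ?C by (rule ring_cyclic_sum)
      have "f (L \<oplus>\<^bsub>?C\<^esub> M) = lin_comb y (\<lambda>i. r L i + r M i) {..<k}"
        using L M by (intro f_eq) (simp_all add: nth_cyclic_sum_add r[OF L] r[OF M])
      then show "f (L \<otimes>\<^bsub>add_monoid ?C\<^esub> M) = f L \<otimes> f M"
        by (simp add: f_def lin_comb_add[OF y])
    qed (simp add: f_def y)
    have "inj_on f (carrier ?C)"
    proof (rule inj_onI)
      fix L M assume L: "L \<in> carrier ?C" and M: "M \<in> carrier ?C" and "f L = f M"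
      then have "\<forall>i<k. L ! i = M ! i"
        unfolding f_def eq_iff using r by metis
      then show "L = M" using L M mem by (intro nth_equalityI) auto
    qed
    moreover have "g \<in> f ` carrier ?C" if "g \<in> carrier G" for g
    proof -
      obtain c where c: "g = lin_comb y c {..<k}"
        using \<open>g \<in> carrier G\<close> unfolding span[symmetric] lin_span_def by auto
      let ?L = "map (\<lambda>i. ZMod (int (n i)) (c i)) [0..<k]"
      have L: "?L \<in> carrier ?C" by (simp add: mem)
      have "g = f ?L" unfolding c by (rule f_eq[OF L, symmetric]) simp
      with L show ?thesis by blast
    qed
    ultimately show "bij_betw f (carrier (add_monoid ?C)) (carrier G)"
      unfolding bij_betw_def using y by (auto simp: f_def)
  qed
  then show ?thesis by (rule is_isoI)
qed

text \<open>
  The family of all elements generates the group, so \<open>ex_basis\<close> applies to it.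
\<close>
theorem finite_abelian_group_decomposition:
  assumes "finite (carrier G)"
  shows "\<exists>ns. (\<forall>n\<in>set ns. n \<ge> 1) \<and> add_monoid (cyclic_sum ns) \<cong> G"
proof -
  obtain x where x: "bij_betw x {..<card (carrier G)} (carrier G)"
    using ex_bij_betw_nat_finite[OF assms] by (auto simp: lessThan_atLeast0)
  let ?I = "{..<card (carrier G)}"
  have xG: "x \<in> ?I \<rightarrow> carrier G" using x by (auto simp: bij_betw_def)
  have "g \<in> lin_span x ?I" if "g \<in> carrier G" for g
  proof -
    have "g \<in> x ` ?I" using x \<open>g \<in> carrier G\<close> by (simp add: bij_betw_def)
    then obtain i where i: "i \<in> ?I" "x i = g" by blast
    then have "lin_comb x (\<lambda>j. if j = i then 1 else 0) ?I = g"
      using lin_comb_single[OF _ i(1) xG, of 1] that by simp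
    then show ?thesis unfolding lin_span_def by auto
  qed
  then have span: "lin_span x ?I = carrier G"
    using xG unfolding lin_span_def by auto
  obtain y n where y: "y \<in> ?I \<rightarrow> carrier G" "lin_span y ?I = lin_span x ?I"
    and n: "\<And>i. i \<in> ?I \<Longrightarrow> (0::nat) < n i"
    and rel: "\<And>c. lin_comb y c ?I = \<one> \<longleftrightarrow> (\<forall>i\<in>?I. int (n i) dvd c i)"
    using ex_basis[OF assms _ xG] by blast
  have "add_monoid (cyclic_sum (map n [0..<card (carrier G)])) \<cong> G"
    using y span rel by (intro basis_imp_iso) auto
  moreover have "\<forall>m\<in>set (map n [0..<card (carrier G)]). m \<ge> 1"
    using n by (auto simp: Suc_le_eq)
  ultimately show ?thesis by blast
qed

end

section \<open>Counting torsion elements\<close>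

text \<open>
  An isomorphism invariant of a group that is multiplicative on products and easy to compute for
  cyclic groups, which makes it suitable for recovering a decomposition.
\<close>
definition torsion_count :: "('a, 'b) monoid_scheme \<Rightarrow> nat \<Rightarrow> nat" where
  "torsion_count G m = card {x \<in> carrier G. x [^]\<^bsub>G\<^esub> m = \<one>\<^bsub>G\<^esub>}"

lemma torsion_count_iso:
  assumes "group G" "group H" "G \<cong> H"
  shows "torsion_count G m = torsion_count H m"
proof -
  obtain h where h: "h \<in> iso G H" using assms by (auto simp: is_iso_def)
  interpret group_hom G H h
    using assms h by (auto simp: group_hom_def group_hom_axioms_def iso_def)
  have inj: "inj_on h (carrier G)" and img: "h ` carrier G = carrier H"
    using h by (auto simp: iso_def bij_betw_def)
  have iff: "h x [^]\<^bsub>H\<^esub> m = \<one>\<^bsub>H\<^esub> \<longleftrightarrow> x [^]\<^bsub>G\<^esub> m = \<one>\<^bsub>G\<^esub>" if "x \<in> carrier G" for x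
    using that inj hom_nat_pow[of x m] hom_one
    by (metis G.nat_pow_closed G.one_closed inj_onD)
  have "bij_betw h {x \<in> carrier G. x [^]\<^bsub>G\<^esub> m = \<one>\<^bsub>G\<^esub>} {x \<in> carrier H. x [^]\<^bsub>H\<^esub> m = \<one>\<^bsub>H\<^esub>}"
    unfolding bij_betw_def img[symmetric]
    using iff inj by (auto intro: inj_on_subset)
  then show ?thesis unfolding torsion_count_def by (rule bij_betw_same_card)
qed

lemma DirProd_nat_pow: "(x, y) [^]\<^bsub>G \<times>\<times> H\<^esub> (m::nat) = (x [^]\<^bsub>G\<^esub> m, y [^]\<^bsub>H\<^esub> m)"
  by (induction m) auto

lemma torsion_count_DirProd:
  "torsion_count (G \<times>\<times> H) m = torsion_count G m * torsion_count H m"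
proof -
  have "{z \<in> carrier (G \<times>\<times> H). z [^]\<^bsub>G \<times>\<times> H\<^esub> m = \<one>\<^bsub>G \<times>\<times> H\<^esub>}
    = {x \<in> carrier G. x [^]\<^bsub>G\<^esub> m = \<one>\<^bsub>G\<^esub>} \<times> {x \<in> carrier H. x [^]\<^bsub>H\<^esub> m = \<one>\<^bsub>H\<^esub>}"
    by (auto simp: DirProd_nat_pow)
  then show ?thesis by (simp add: torsion_count_def card_cartesian_product)
qed

lemma ZMod_nat_pow: "ZMod n a [^]\<^bsub>add_monoid (ZFact n)\<^esub> (m::nat) = ZMod n (int m * a)"
  by (induction m) (auto simp: ZMod_zero algebra_simps)

text \<open>
  With \<open>g = gcd(m, n)\<close> and \<open>n = d g\<close>, the solutions of \<open>n dvd m a\<close> are the multiples of \<open>d\<close>, of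
  which there are \<open>g\<close> below \<open>n\<close>.
\<close>
lemma card_multiples_mod:
  fixes n m :: nat
  assumes "n > 0"
  shows "card {a \<in> {0..<int n}. int n dvd int m * a} = gcd m n"
proof -
  define g where "g = gcd m n"
  have g: "g > 0" using assms by (simp add: g_def)
  define d where "d = n div g"
  have n: "n = d * g" by (simp add: d_def g_def)
  have d: "d > 0" using n assms by (cases d) auto
  obtain m' where m: "m = m' * g" using g_def by (metis dvd_div_mult_self gcd_dvd1)
  have "coprime d m'"
    using assms g n m unfolding g_def by (metis coprime_commute div_gcd_coprime d_def g_def nonzero_mult_div_cancel_right gr_implies_not0)
  have "int n dvd int m * a \<longleftrightarrow> int d dvd a" for a
  proof -
    have "int n dvd int m * a \<longleftrightarrow> int d * int g dvd (int m' * a) * int g"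
      by (simp add: n m mult_ac)
    also have "\<dots> \<longleftrightarrow> int d dvd int m' * a" using g by simp
    also have "\<dots> \<longleftrightarrow> int d dvd a"
      using \<open>coprime d m'\<close> by (simp add: coprime_dvd_mult_right_iff)
    finally show ?thesis .
  qed
  then have "{a \<in> {0..<int n}. int n dvd int m * a} = (\<lambda>j. int d * int j) ` {..<g}"
  proof -
    have "a \<in> (\<lambda>j. int d * int j) ` {..<g}" if "0 \<le> a" "a < int n" "int d dvd a" for a
    proof -
      from \<open>int d dvd a\<close> obtain j where j: "a = int d * j" by auto
      then have "0 \<le> j" using that d by (simp add: zero_le_mult_iff)
      moreover have "j < int g" using that j d n by simp
      ultimately show ?thesis using j by (intro image_eqI[of _ _ "nat j"]) auto
    qed
    moreover have "int d * int j < int n" if "j < g" for j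
      using that d n by simp
    ultimately show ?thesis using \<open>\<And>a. (int n dvd int m * a) = (int d dvd a)\<close> by auto
  qed
  moreover have "inj_on (\<lambda>j. int d * int j) {..<g}" using d by (auto simp: inj_on_def)
  ultimately show ?thesis by (simp add: card_image g_def)
qed

lemma torsion_count_ZFact:
  assumes "n > 0"
  shows "torsion_count (add_monoid (ZFact (int n))) m = gcd m n"
proof -
  define P where "P x \<longleftrightarrow> x [^]\<^bsub>add_monoid (ZFact (int n))\<^esub> m = \<zero>\<^bsub>ZFact (int n)\<^esub>" for x
  have "P (ZMod (int n) a) \<longleftrightarrow> int n dvd int m * a" for a
    unfolding P_def ZMod_nat_pow unfolding ZMod_zero ZMod_eq_iff by simp
  then have "{x \<in> carrier (ZFact (int n)). P x}
     = ZMod (int n) ` {a \<in> {0..<int n}. int n dvd int m * a}"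
    using assms by (auto simp: ZFact_image)
  moreover have "inj_on (ZMod (int n)) {a \<in> {0..<int n}. int n dvd int m * a}"
    by (rule inj_on_subset[OF inj_on_ZMod]) auto
  ultimately show ?thesis
    using assms by (simp add: torsion_count_def P_def card_image card_multiples_mod[OF assms, of m, simplified])
qed

lemma group_add_monoid: "ring R \<Longrightarrow> group (add_monoid R)"
  using abelian_group.a_group ring.is_abelian_group by blast

lemma torsion_count_cyclic_sum:
  assumes "\<forall>n\<in>set ns. n \<ge> 1"
  shows "torsion_count (add_monoid (cyclic_sum ns)) m = prod_list (map (gcd m) ns)"
  using assms
proof (induction ns)
  case Nil
  have "x [^]\<^bsub>add_monoid (cyclic_sum [])\<^esub> m = []" for x
    by (induction m) (auto simp: cyclic_sum_def monoid.defs)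
  then show ?case by (simp add: torsion_count_def cyclic_sum_def monoid.defs)
next
  case (Cons n ns)
  have "torsion_count (add_monoid (cyclic_sum (n # ns))) m
      = torsion_count (add_monoid (RDirProd (ZFact (int n)) (cyclic_sum ns))) m"
    by (intro torsion_count_iso group_add_monoid is_ring_iso_add cyclic_sum_Cons_sym RDirProd_ring
        ring_cyclic_sum ring_ZFact)
  also have "\<dots> = gcd m n * prod_list (map (gcd m) ns)"
    unfolding RDirProd_add_monoid torsion_count_DirProd using Cons by (subst torsion_count_ZFact) auto
  finally show ?case by simp
qed

section \<open>Uniqueness of the ring structure\<close>

lemma gcd_mult_coprime:
  fixes a b x :: nat
  assumes "coprime a b"
  shows "gcd x (a * b) = gcd x a * gcd x b"
proof (rule dvd_antisym)
  obtain b' c' where "gcd x (a * b) = b' * c'" "b' dvd a" "c' dvd b"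
    using division_decomp[of "gcd x (a * b)" a b] by auto
  moreover from this have "b' dvd x" "c' dvd x"
    by (metis dvd_mult_left dvd_mult_right gcd_dvd1)+
  ultimately show "gcd x (a * b) dvd gcd x a * gcd x b" by (simp add: mult_dvd_mono)
  have "coprime (gcd x a) (gcd x b)"
    using assms by (meson coprime_divisors gcd_dvd2)
  then show "gcd x a * gcd x b dvd gcd x (a * b)"
    by (intro gcd_greatest divides_mult mult_dvd_mono) auto
qed

lemma cyclic_sum_trivial: "\<forall>n\<in>set ns. n = 1 \<Longrightarrow> cyclic_sum ns \<simeq> cyclic_sum []"
proof (induction ns)
  case (Cons n ns)
  have 1: "carrier (ZFact 1) = {\<zero>\<^bsub>ZFact 1\<^esub>}"
  proof -
    have "{0..<1::int} = {0}" by auto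
    then show ?thesis using ZFact_image[of 1] by (simp add: ZMod_zero)
  qed
  have "cyclic_sum (n # ns) \<simeq> RDirProd (ZFact 1) (cyclic_sum ns)"
    using cyclic_sum_Cons_sym[of n ns] Cons by simp
  also have "\<dots> \<simeq> RDirProd (cyclic_sum ns) (ZFact 1)" by (rule RDirProd_comm)
  also have "\<dots> \<simeq> cyclic_sum ns"
    by (rule ring_iso_sym[OF ring_cyclic_sum RDirProd_trivial[OF ring_cyclic_sum ring_ZFact 1]])
  also have "\<dots> \<simeq> cyclic_sum []" using Cons by simp
  finally show ?case .
qed (rule ring_iso_refl)

lemma cyclic_sum_split:
  assumes "coprime a b"
  shows "cyclic_sum (us @ (a * b) # vs) \<simeq> RDirProd (ZFact (int a)) (cyclic_sum (b # us @ vs))"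
proof -
  have "cyclic_sum (us @ (a * b) # vs) \<simeq> RDirProd (ZFact (int a * int b)) (cyclic_sum (us @ vs))"
    using cyclic_sum_extract[of us "a * b" vs] by simp
  also have "\<dots> \<simeq> RDirProd (RDirProd (ZFact (int a)) (ZFact (int b))) (cyclic_sum (us @ vs))"
    using assms by (intro RDirProd_cong ZFact_mult_coprime ring_iso_refl) simp
  also have "\<dots> \<simeq> RDirProd (ZFact (int a)) (RDirProd (ZFact (int b)) (cyclic_sum (us @ vs)))"
    by (rule RDirProd_assoc)
  also have "\<dots> \<simeq> RDirProd (ZFact (int a)) (cyclic_sum (b # us @ vs))"
    by (intro RDirProd_cong cyclic_sum_Cons ring_iso_refl)
  finally show ?thesis .
qed

text \<open>
  Passing from \<open>q\<^sup>e\<close> to \<open>q\<^sup>e\<^sup>+\<^sup>1\<close> enlarges the gcd with \<open>n\<close> only if \<open>q\<^sup>e\<^sup>+\<^sup>1\<close> itself divides \<open>n\<close>. For a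
  product of such gcds, \<open>prod_gcd_prime_power_step\<close> detects in this way whether \<open>q\<^sup>e\<^sup>+\<^sup>1\<close> divides some
  entry of a list.
\<close>
lemma gcd_prime_power_step:
  fixes n q e :: nat
  assumes "Factorial_Ring.prime q" "n > 0"
  shows "gcd (q ^ e) n \<le> gcd (q ^ Suc e) n" "gcd (q ^ e) n < gcd (q ^ Suc e) n \<longleftrightarrow> q ^ Suc e dvd n"
proof -
  have "gcd (q ^ e) n dvd gcd (q ^ Suc e) n" by (rule gcd_mono) auto
  then show le: "gcd (q ^ e) n \<le> gcd (q ^ Suc e) n" using assms(2) by (intro dvd_imp_le) auto
  have "gcd (q ^ Suc e) n = gcd (q ^ e) n" if "\<not> q ^ Suc e dvd n"
  proof -
    obtain i where i: "i \<le> Suc e" "gcd (q ^ Suc e) n = q ^ i"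
      using divides_primepow_nat[OF assms(1), of "gcd (q ^ Suc e) n" "Suc e"] by auto
    with that have "i \<noteq> Suc e" by (metis gcd_dvd2)
    then have "gcd (q ^ Suc e) n dvd gcd (q ^ e) n"
      using i gcd_dvd2[of "q ^ Suc e" n] by (intro gcd_greatest) (auto simp: le_imp_power_dvd simp del: gcd_dvd2)
    with le show ?thesis using assms by (intro antisym dvd_imp_le) (auto simp: prime_gt_0_nat)
  qed
  moreover have "gcd (q ^ e) n < gcd (q ^ Suc e) n" if "q ^ Suc e dvd n"
  proof -
    have "q ^ e dvd n" using that by (rule power_le_dvd) simp
    then have "gcd (q ^ e) n = q ^ e" "gcd (q ^ Suc e) n = q ^ Suc e" using that by (auto simp: gcd_nat.absorb1)
    then show ?thesis using prime_gt_1_nat[OF assms(1)] by simp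
  qed
  ultimately show "gcd (q ^ e) n < gcd (q ^ Suc e) n \<longleftrightarrow> q ^ Suc e dvd n"
    by (cases "q ^ Suc e dvd n") (simp_all only: less_irrefl not_True_eq_False not_False_eq_True simp_thms)
qed

lemma prod_gcd_prime_power_step:
  fixes ns :: "nat list"
  assumes "Factorial_Ring.prime q" "\<forall>n\<in>set ns. n \<ge> 1"
  shows "prod_list (map (gcd (q ^ e)) ns) \<noteq> prod_list (map (gcd (q ^ Suc e)) ns) \<longleftrightarrow>
         (\<exists>n\<in>set ns. q ^ Suc e dvd n)"
proof -
  have "prod_list (map (gcd (q ^ e)) ns) \<le> prod_list (map (gcd (q ^ Suc e)) ns) \<and>
        (prod_list (map (gcd (q ^ e)) ns) < prod_list (map (gcd (q ^ Suc e)) ns) \<longleftrightarrow>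
         (\<exists>n\<in>set ns. q ^ Suc e dvd n)) \<and> 0 < prod_list (map (gcd (q ^ e)) ns)"
    using assms(2)
  proof (induction ns)
    case (Cons n ns)
    define A where "A = prod_list (map (gcd (q ^ e)) ns)"
    define B where "B = prod_list (map (gcd (q ^ Suc e)) ns)"
    define a where "a = gcd (q ^ e) n"
    define b where "b = gcd (q ^ Suc e) n"
    have n: "n > 0" using Cons by auto
    have IH: "A \<le> B" "A < B \<longleftrightarrow> (\<exists>n\<in>set ns. q ^ Suc e dvd n)" "0 < A"
      using Cons unfolding A_def B_def by auto
    have ab: "a \<le> b" "a < b \<longleftrightarrow> q ^ Suc e dvd n" "0 < a"
      using gcd_prime_power_step[OF assms(1) n] n unfolding a_def b_def by auto
    have "a * A \<le> b * B" using ab IH by (intro mult_mono) auto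
    moreover have "a * A < b * B \<longleftrightarrow> a < b \<or> A < B"
    proof
      assume "a * A < b * B"
      then show "a < b \<or> A < B" using ab IH by (metis le_neq_implies_less less_irrefl)
    next
      assume "a < b \<or> A < B"
      then show "a * A < b * B"
        using ab IH by (auto intro: mult_less_le_imp_less mult_le_less_imp_less)
    qed
    ultimately show ?case
      using IH ab
      unfolding list.map prod_list.Cons A_def[symmetric] B_def[symmetric] a_def[symmetric] b_def[symmetric]
      by auto
  qed auto
  then show ?thesis by auto
qed

text \<open>
  Induction on the product of the \<open>n\<^sub>i\<close>. Let a prime \<open>q\<close> divide this product, and let \<open>q\<^sup>e\<close> be the
  largest power of \<open>q\<close> that divides some \<open>n\<^sub>i\<close>. The gcd products detect \<open>q\<^sup>e\<close>, so it is also the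
  largest power of \<open>q\<close> dividing some \<open>m\<^sub>j\<close>. Hence \<open>n\<^sub>i = q\<^sup>e b\<close> and \<open>m\<^sub>j = q\<^sup>e b'\<close> with \<open>b\<close> and \<open>b'\<close>
  prime to \<open>q\<close>, and both rings have \<open>\<int>/q\<^sup>e\<close> as a direct factor. Removing it divides the gcd products
  on both sides by the same number \<open>gcd(x, q\<^sup>e)\<close>.
\<close>
lemma cyclic_sum_isoI:
  assumes "\<forall>n\<in>set ns. n \<ge> 1" "\<forall>n\<in>set ms. n \<ge> 1"
    and "\<And>x. prod_list (map (gcd x) ns) = prod_list (map (gcd x) ms)"
  shows "cyclic_sum ns \<simeq> cyclic_sum ms"
  using assms
proof (induction "prod_list ns" arbitrary: ns ms rule: less_induct)
  case less
  have gcd_id: "prod_list (map (gcd x) l) = prod_list l" if "\<forall>n\<in>set l. n dvd x" for x :: nat and l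
    using that by (induction l) (auto simp: gcd_nat.absorb2)
  have dvd_prod: "n dvd prod_list l" if "n \<in> set l" for n :: nat and l
    using that by (induction l) auto
  \<comment> \<open>Taking a common multiple of all entries for \<open>x\<close> turns the gcd products into plain products.\<close>
  have prod_eq: "prod_list ns = prod_list ms"
    using less(4)[of "prod_list ns * prod_list ms"] gcd_id[of ns "prod_list ns * prod_list ms"]
      gcd_id[of ms "prod_list ns * prod_list ms"] dvd_prod by auto
  show ?case
  proof (cases "prod_list ns = 1")
    case True
    then have "\<forall>n\<in>set ns. n = 1" "\<forall>n\<in>set ms. n = 1"
      using dvd_prod[of _ ns] dvd_prod[of _ ms] prod_eq by auto
    then show ?thesis
      by (intro ring_iso_trans[OF cyclic_sum_trivial ring_iso_sym[OF ring_cyclic_sum cyclic_sum_trivial]])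
  next
    case False
    then obtain q where q: "Factorial_Ring.prime q" "q dvd prod_list ns"
      using prime_factor_nat by blast
    have "ns \<noteq> []" using False by auto
    define e where "e = Max (multiplicity q ` set ns)"
    have "e \<in> multiplicity q ` set ns"
      unfolding e_def using \<open>ns \<noteq> []\<close> by (intro Max_in) auto
    then obtain n where n: "n \<in> set ns" "multiplicity q n = e" by auto
    have max: "multiplicity q n' \<le> e" if "n' \<in> set ns" for n'
      unfolding e_def using that by (intro Max_ge) auto
    have nq: "\<not> is_unit q" using q by (metis not_prime_unit)
    have dvd_iff: "q ^ i dvd n' \<longleftrightarrow> i \<le> multiplicity q n'" if "n' \<ge> 1" for n' i
      using that nq by (intro power_dvd_iff_le_multiplicity) auto
    obtain n0 where n0: "n0 \<in> set ns" "q dvd n0"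
    proof -
      have "q dvd prod_list l \<Longrightarrow> \<exists>n\<in>set l. q dvd n" for l
        using q(1) by (induction l) (auto simp: prime_dvd_mult_iff not_prime_unit)
      with q(2) that show ?thesis by blast
    qed
    have "e > 0"
      using max[OF n0(1)] n0 dvd_iff[of n0 1] less(2) by simp
    then obtain e' where e': "e = Suc e'" by (cases e) auto
    have crit: "(\<exists>n\<in>set ns. q ^ Suc i dvd n) \<longleftrightarrow> (\<exists>m\<in>set ms. q ^ Suc i dvd m)" for i
      using prod_gcd_prime_power_step[OF q(1) less(2), of i]
        prod_gcd_prime_power_step[OF q(1) less(3), of i] less(4) by simp
    have "q ^ e dvd n" using dvd_iff[of n e] n less(2) by simp
    then obtain m where m: "m \<in> set ms" "q ^ e dvd m" using crit[of e'] n e' by auto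
    have "\<not> q ^ Suc e dvd m"
    proof
      assume "q ^ Suc e dvd m"
      then obtain n' where "n' \<in> set ns" "q ^ Suc e dvd n'" using crit[of e] m(1) by auto
      then show False using max[of n'] dvd_iff[of n' "Suc e"] less(2) by force
    qed
    have "\<not> q ^ Suc e dvd n" using dvd_iff[of n "Suc e"] n less(2) by simp
    have split: "\<exists>us vs b. l = us @ (q ^ e * b) # vs \<and> coprime (q ^ e) b"
      if "x \<in> set l" "q ^ e dvd x" "\<not> q ^ Suc e dvd x" for x l
    proof -
      obtain us vs where "l = us @ x # vs" using \<open>x \<in> set l\<close> by (meson split_list)
      moreover obtain b where b: "x = q ^ e * b" using \<open>q ^ e dvd x\<close> by auto
      moreover have "coprime (q ^ e) b"
        using that b q(1) by (auto simp: prime_imp_coprime coprime_power_left_iff)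
      ultimately show ?thesis by blast
    qed
    obtain us vs b where ns: "ns = us @ (q ^ e * b) # vs" and b: "coprime (q ^ e) b"
      using split[OF n(1) \<open>q ^ e dvd n\<close> \<open>\<not> q ^ Suc e dvd n\<close>] by blast
    obtain us' vs' b' where ms: "ms = us' @ (q ^ e * b') # vs'" and b': "coprime (q ^ e) b'"
      using split[OF m(1) m(2) \<open>\<not> q ^ Suc e dvd m\<close>] by blast
    have q1: "q ^ e > 1" using prime_gt_1_nat[OF q(1)] \<open>e > 0\<close> by (intro one_less_power)
    have pos: "\<forall>n\<in>set (b # us @ vs). n \<ge> 1" "\<forall>n\<in>set (b' # us' @ vs'). n \<ge> 1"
      using less(2,3) unfolding ns ms by auto
    have "prod_list l > 0" if "\<forall>n\<in>set l. n \<ge> 1" for l :: "nat list"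
      using that by (induction l) auto
    from this[OF pos(1)] have "prod_list (b # us @ vs) > 0" .
    have "cyclic_sum (b # us @ vs) \<simeq> cyclic_sum (b' # us' @ vs')"
    proof (rule less.hyps[OF _ pos])
      have "prod_list ns = q ^ e * prod_list (b # us @ vs)" by (simp add: ns mult_ac)
      then show "prod_list (b # us @ vs) < prod_list ns"
        using q1 \<open>prod_list (b # us @ vs) > 0\<close> by simp
      fix x
      have "gcd x (q ^ e) * prod_list (map (gcd x) (b # us @ vs)) = gcd x (q ^ e) * prod_list (map (gcd x) (b' # us' @ vs'))"
        using less(4)[of x]
        unfolding ns ms map_append list.map prod_list.append prod_list.Cons
          gcd_mult_coprime[OF b] gcd_mult_coprime[OF b'] by (simp only: mult_ac)
      then show "prod_list (map (gcd x) (b # us @ vs)) = prod_list (map (gcd x) (b' # us' @ vs'))"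
        using q1 prime_gt_0_nat[OF q(1)] by simp
    qed
    then have "RDirProd (ZFact (int (q ^ e))) (cyclic_sum (b # us @ vs)) \<simeq>
        RDirProd (ZFact (int (q ^ e))) (cyclic_sum (b' # us' @ vs'))"
      by (intro RDirProd_cong ring_iso_refl)
    moreover have "cyclic_sum ns \<simeq> RDirProd (ZFact (int (q ^ e))) (cyclic_sum (b # us @ vs))"
      unfolding ns by (rule cyclic_sum_split[OF b])
    moreover have "RDirProd (ZFact (int (q ^ e))) (cyclic_sum (b' # us' @ vs')) \<simeq> cyclic_sum ms"
      unfolding ms by (intro ring_iso_sym[OF ring_cyclic_sum] cyclic_sum_split[OF b'])
    ultimately show ?thesis by (meson ring_iso_trans)
  qed
qed

section \<open>The ring of units\<close>

text \<open>
  Every ring of units of a finite commutative ring is of this kind, so the iteration never leaves this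
  class, on which isomorphism of additive groups implies isomorphism of rings. Being a ring is
  required separately, since an isomorphism in the sense of \<open>\<simeq>\<close> does not constrain the zero of its target.
\<close>
definition cyclic_type :: "('a, 'b) ring_scheme \<Rightarrow> bool" where
  "cyclic_type R \<longleftrightarrow> ring R \<and> (\<exists>ns. (\<forall>n\<in>set ns. n \<ge> 1) \<and> cyclic_sum ns \<simeq> R)"

lemma cyclic_type_imp_ring: "cyclic_type R \<Longrightarrow> ring R"
  by (simp add: cyclic_type_def)

lemma cyclic_type_imp_cring: "cyclic_type R \<Longrightarrow> cring R"
  unfolding cyclic_type_def using cring_iso[OF cring_cyclic_sum] by blast

lemma cyclic_type_imp_finite:
  assumes "cyclic_type R" shows "finite (carrier R)"
proof -
  obtain ns where "\<forall>n\<in>set ns. n \<ge> 1" "cyclic_sum ns \<simeq> R"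
    using assms unfolding cyclic_type_def by blast
  then show ?thesis
    using finite_cyclic_sum[of ns] bij_betw_finite
    unfolding is_ring_iso_def ring_iso_def by blast
qed

lemma cyclic_type_iso:
  assumes "cyclic_type R" "ring S" "R \<simeq> S" shows "cyclic_type S"
proof -
  obtain ns where "\<forall>n\<in>set ns. n \<ge> 1" "cyclic_sum ns \<simeq> R"
    using assms(1) unfolding cyclic_type_def by blast
  with assms(2) ring_iso_trans[OF _ assms(3), of "cyclic_sum ns"] show ?thesis
    unfolding cyclic_type_def by (intro conjI exI[of _ ns]) auto
qed

lemma cyclic_type_cyclic_sum: "\<forall>n\<in>set ns. n \<ge> 1 \<Longrightarrow> cyclic_type (cyclic_sum ns)"
  unfolding cyclic_type_def using ring_cyclic_sum ring_iso_refl by blast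

lemma cyclic_type_ZFact:
  assumes "n \<ge> 1" shows "cyclic_type (ZFact (int n))"
  by (rule cyclic_type_iso[OF cyclic_type_cyclic_sum[of "[n]"] ring_ZFact
        ring_iso_sym[OF ring_ZFact cyclic_sum_single]]) (use assms in simp)

lemma cyclic_type_RDirProd:
  assumes "cyclic_type R" "cyclic_type S" shows "cyclic_type (RDirProd R S)"
proof -
  obtain ns ms where *: "\<forall>n\<in>set ns. n \<ge> 1" "cyclic_sum ns \<simeq> R" "\<forall>n\<in>set ms. n \<ge> 1" "cyclic_sum ms \<simeq> S"
    using assms unfolding cyclic_type_def by blast
  have "cyclic_sum (ns @ ms) \<simeq> RDirProd (cyclic_sum ns) (cyclic_sum ms)"
    by (rule ring_iso_sym[OF RDirProd_ring[OF ring_cyclic_sum ring_cyclic_sum] cyclic_sum_append])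
  also have "\<dots> \<simeq> RDirProd R S" using * by (intro RDirProd_cong)
  finally show ?thesis
    using * assms unfolding cyclic_type_def
    by (intro conjI exI[of _ "ns @ ms"] RDirProd_ring) auto
qed

text \<open>
  Such a ring is determined by its additive group, because the torsion counts of the additive group
  are the gcd products of \<open>cyclic_sum_isoI\<close>.
\<close>
theorem cyclic_type_unique:
  assumes "cyclic_type R" "cyclic_type S" "add_monoid R \<cong> add_monoid S"
  shows "R \<simeq> S"
proof -
  obtain ns ms where ns: "\<forall>n\<in>set ns. n \<ge> 1" "cyclic_sum ns \<simeq> R"
    and ms: "\<forall>n\<in>set ms. n \<ge> 1" "cyclic_sum ms \<simeq> S"
    using assms unfolding cyclic_type_def by blast
  have grp: "group (add_monoid R)" "group (add_monoid S)"
    using assms cyclic_type_imp_ring group_add_monoid by blast+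
  have "prod_list (map (gcd x) ns) = prod_list (map (gcd x) ms)" for x
  proof -
    have "prod_list (map (gcd x) ns) = torsion_count (add_monoid (cyclic_sum ns)) x"
      by (rule torsion_count_cyclic_sum[OF ns(1), symmetric])
    also have "\<dots> = torsion_count (add_monoid R) x"
      using ns grp by (intro torsion_count_iso is_ring_iso_add group_add_monoid[OF ring_cyclic_sum]) auto
    also have "\<dots> = torsion_count (add_monoid S) x"
      using grp assms(3) by (intro torsion_count_iso)
    also have "\<dots> = torsion_count (add_monoid (cyclic_sum ms)) x"
      using ms grp by (intro torsion_count_iso[symmetric] is_ring_iso_add group_add_monoid[OF ring_cyclic_sum]) auto
    also have "\<dots> = prod_list (map (gcd x) ms)"
      by (rule torsion_count_cyclic_sum[OF ms(1)])
    finally show ?thesis .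
  qed
  with ns ms have "cyclic_sum ns \<simeq> cyclic_sum ms" by (intro cyclic_sum_isoI)
  have "R \<simeq> cyclic_sum ns" by (rule ring_iso_sym[OF ring_cyclic_sum ns(2)])
  also have "\<dots> \<simeq> cyclic_sum ms" by fact
  also have "\<dots> \<simeq> S" by fact
  finally show ?thesis .
qed

text \<open>
  The decomposition theorem provides a candidate for the choice in \<open>unit_ring\<close>. These two properties
  characterise the result up to isomorphism, by \<open>cyclic_type_unique\<close>.
\<close>
theorem unit_ring_of_finite_cring:
  fixes R :: "('a, 'b) ring_scheme"
  assumes "cring R" "finite (carrier R)"
  shows "cyclic_type (unit_ring R)" "add_monoid (unit_ring R) \<cong> units_of R"
proof -
  interpret cring R by fact
  interpret U: comm_group "units_of R" by (rule units_comm_group)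
  have "finite (carrier (units_of R))"
    unfolding units_of_carrier by (rule finite_subset[OF _ assms(2)]) auto
  then obtain ns where "\<forall>n\<in>set ns. n \<ge> 1" "add_monoid (cyclic_sum ns) \<cong> units_of R"
    using U.finite_abelian_group_decomposition by blast
  then have "\<exists>S. is_unit_ring R S"
    unfolding is_unit_ring_def is_iso_def by blast
  then have "is_unit_ring R (unit_ring R)"
    unfolding unit_ring_def by (rule someI_ex)
  then obtain ns f where ns: "\<forall>n\<in>set ns. n \<ge> 1"
    and f: "f \<in> iso (add_monoid (cyclic_sum ns)) (units_of R)"
    and S: "unit_ring R = image_ring f (cyclic_sum ns)"
    unfolding is_unit_ring_def by blast
  have inj: "inj_on f (carrier (cyclic_sum ns))"
    using f by (simp add: iso_def bij_betw_def)
  have iso: "cyclic_sum ns \<simeq> unit_ring R"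
    unfolding S using inj_imp_image_ring_iso[OF inj] is_ring_iso_def by blast
  have "ring (unit_ring R)"
    unfolding S by (rule ring.inj_imp_image_ring_is_ring[OF ring_cyclic_sum inj])
  then show "cyclic_type (unit_ring R)" unfolding cyclic_type_def using ns iso by blast
  have "add_monoid (unit_ring R) \<cong> add_monoid (cyclic_sum ns)"
    by (rule is_ring_iso_add[OF ring_iso_sym[OF ring_cyclic_sum iso]])
  also have "\<dots> \<cong> units_of R" using f by (rule is_isoI)
  finally show "add_monoid (unit_ring R) \<cong> units_of R" .
qed

lemma cyclic_type_unit_ring: "cyclic_type R \<Longrightarrow> cyclic_type (unit_ring R)"
  by (intro unit_ring_of_finite_cring cyclic_type_imp_cring cyclic_type_imp_finite)

lemma add_monoid_unit_ring: "cyclic_type R \<Longrightarrow> add_monoid (unit_ring R) \<cong> units_of R"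
  by (intro unit_ring_of_finite_cring cyclic_type_imp_cring cyclic_type_imp_finite)

text \<open>
  The tool for all computations of rings of units: it is enough to identify the group of units.
\<close>
lemma unit_ring_eqI:
  assumes "cyclic_type R" "cyclic_type S" "units_of R \<cong> add_monoid S"
  shows "unit_ring R \<simeq> S"
  using assms by (intro cyclic_type_unique cyclic_type_unit_ring iso_trans[OF add_monoid_unit_ring])

lemma group_units_of_cyclic_type: "cyclic_type R \<Longrightarrow> group (units_of R)"
  using cyclic_type_imp_ring monoid.units_group ring.is_monoid by blast

lemma unit_ring_cong:
  assumes "cyclic_type R" "cyclic_type S" "R \<simeq> S"
  shows "unit_ring R \<simeq> unit_ring S"
proof (rule unit_ring_eqI[OF assms(1) cyclic_type_unit_ring[OF assms(2)]])
  have "units_of R \<cong> units_of S"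
    using assms by (intro is_ring_iso_units cyclic_type_imp_ring)
  also have "\<dots> \<cong> add_monoid (unit_ring S)"
    using assms by (intro group.iso_sym[OF _ add_monoid_unit_ring] group_add_monoid cyclic_type_imp_ring cyclic_type_unit_ring)
  finally show "units_of R \<cong> add_monoid (unit_ring S)" .
qed

lemma unit_ring_RDirProd:
  assumes "cyclic_type R" "cyclic_type S"
  shows "unit_ring (RDirProd R S) \<simeq> RDirProd (unit_ring R) (unit_ring S)"
proof (rule unit_ring_eqI)
  have "units_of (RDirProd R S) \<cong> units_of R \<times>\<times> units_of S"
    using assms by (intro units_of_RDirProd cyclic_type_imp_ring)
  also have "\<dots> \<cong> add_monoid (unit_ring R) \<times>\<times> add_monoid (unit_ring S)"
    using assms by (intro group.DirProd_iso_trans group_units_of_cyclic_type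
        group.iso_sym[OF _ add_monoid_unit_ring] group_add_monoid cyclic_type_imp_ring cyclic_type_unit_ring)
  finally show "units_of (RDirProd R S) \<cong> add_monoid (RDirProd (unit_ring R) (unit_ring S))"
    by (simp only: RDirProd_add_monoid)
qed (use assms in \<open>auto intro: cyclic_type_RDirProd cyclic_type_unit_ring\<close>)

section \<open>Units modulo an odd prime power\<close>

lemma ZMod_unit_iff: "ZMod n a \<in> Units (ZFact n) \<longleftrightarrow> coprime a n"
proof -
  have "ZMod n a \<in> Units (ZFact n) \<longleftrightarrow> (\<exists>b. ZMod n (a * b) = ZMod n 1)"
    unfolding Units_def by (auto simp: carrier_ZFact ZMod_one mult.commute)
  also have "\<dots> \<longleftrightarrow> coprime a n"
    by (simp add: ZMod_eq_mod coprime_iff_invertible_int cong_def)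
  finally show ?thesis .
qed

text \<open>
  A primitive root, regarded as a family with a single member, is a basis of the group of units.
\<close>
lemma units_of_ZFact_primroot:
  fixes N g :: nat
  assumes N: "N > 1" and g: "residue_primroot N g"
  shows "add_monoid (cyclic_sum [totient N]) \<cong> units_of (ZFact (int N))"
proof -
  interpret R: cring "ZFact (int N)" by (rule ZFact_is_cring)
  interpret U: comm_group "units_of (ZFact (int N))" by (rule R.units_comm_group)
  let ?x = "ZMod (int N) (int g)"
  have cop: "coprime N g" and ord: "Pocklington.ord N g = totient N"
    using g by (auto simp: residue_primroot_def)
  have x: "?x \<in> carrier (units_of (ZFact (int N)))"
    using cop by (simp add: units_of_carrier ZMod_unit_iff coprime_commute)
  have pow: "?x [^]\<^bsub>units_of (ZFact (int N))\<^esub> i = ZMod (int N) (int (g ^ i))" for i :: nat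
    by (induction i) (simp_all add: units_of_one units_of_mult ZMod_one mult.commute)
  have "?x [^]\<^bsub>units_of (ZFact (int N))\<^esub> i = \<one>\<^bsub>units_of (ZFact (int N))\<^esub> \<longleftrightarrow> totient N dvd i" for i :: nat
  proof -
    have "ZMod (int N) (int (g ^ i)) = ZMod (int N) 1 \<longleftrightarrow> [g ^ i = 1] (mod N)"
      using cong_int_iff[of "g ^ i" 1 N] by (simp add: ZMod_eq_mod cong_def)
    then show ?thesis
      using ord_divides[of g i N] by (simp add: pow units_of_one ZMod_one ord)
  qed
  then have "U.ord ?x dvd i \<longleftrightarrow> totient N dvd i" for i
    by (simp only: U.pow_eq_id[OF x])
  from this[of "totient N"] this[of "U.ord ?x"] have "U.ord ?x = totient N"
    by (intro dvd_antisym) simp_all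
  then have int_pow: "?x [^]\<^bsub>units_of (ZFact (int N))\<^esub> c = \<one>\<^bsub>units_of (ZFact (int N))\<^esub> \<longleftrightarrow> int (totient N) dvd c" for c :: int
    using U.int_pow_eq_id[OF x] by simp
  have comb: "U.lin_comb (\<lambda>_. ?x) c {..<1} = ?x [^]\<^bsub>units_of (ZFact (int N))\<^esub> c (0::nat)" for c
    using U.lin_comb_single[of "{..<1::nat}" 0 "\<lambda>_. ?x" "c 0"] x
      U.lin_comb_cong[of "\<lambda>_. ?x" "{..<1::nat}" "\<lambda>_. ?x" c "\<lambda>j. if j = 0 then c 0 else 0"] by simp
  have "add_monoid (cyclic_sum (map (\<lambda>_. totient N) [0..<1])) \<cong> units_of (ZFact (int N))"
  proof (rule U.basis_imp_iso)
    show "(\<lambda>_. ?x) \<in> {..<1} \<rightarrow> carrier (units_of (ZFact (int N)))" using x by simp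
    show "U.lin_span (\<lambda>_. ?x) {..<1::nat} = carrier (units_of (ZFact (int N)))"
    proof (intro equalityI subsetI)
      fix u assume "u \<in> U.lin_span (\<lambda>_. ?x) {..<1::nat}"
      then show "u \<in> carrier (units_of (ZFact (int N)))"
        unfolding U.lin_span_def using x by auto
    next
      fix u assume "u \<in> carrier (units_of (ZFact (int N)))"
      then have "u \<in> Units (ZFact (int N))" by (simp add: units_of_carrier)
      moreover from this obtain a where a: "u = ZMod (int N) a"
        using R.Units_closed carrier_ZFact by blast
      ultimately have "coprime a (int N)" by (simp add: ZMod_unit_iff)
      define b where "b = nat (a mod int N)"
      have b: "int b = a mod int N" using N by (simp add: b_def)
      have "coprime (int b) (int N)"
        unfolding b using \<open>coprime a (int N)\<close> N by (simp add: coprime_mod_left_iff)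
      then have "coprime b N" by simp
      moreover have "b < N" using N by (simp add: b_def nat_less_iff)
      moreover have "b \<noteq> 0" using \<open>coprime b N\<close> N by (intro notI) simp
      ultimately have "b \<in> totatives N" by (simp add: totatives_def)
      then obtain i where "b = g ^ i mod N"
        using residue_primroot_is_generator[OF N g] unfolding bij_betw_def by blast
      then have "u = ZMod (int N) (int (g ^ i))"
        unfolding a ZMod_eq_mod using b by (simp add: of_nat_mod)
      then have "u = U.lin_comb (\<lambda>_. ?x) (\<lambda>_. int i) {..<1::nat}"
        unfolding comb by (simp add: pow int_pow_int)
      then show "u \<in> U.lin_span (\<lambda>_. ?x) {..<1::nat}" unfolding U.lin_span_def by blast
    qed
    show "U.lin_comb (\<lambda>_. ?x) c {..<1} = \<one>\<^bsub>units_of (ZFact (int N))\<^esub> \<longleftrightarrow> (\<forall>i<1. int (totient N) dvd c i)" for c :: "nat \<Rightarrow> int"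
      unfolding comb int_pow by simp
  qed
  then show ?thesis by simp
qed

lemma unit_ring_ZFact_primroot:
  assumes "N > 1" "residue_primroot N g"
  shows "unit_ring (ZFact (int N)) \<simeq> ZFact (int (totient N))"
proof (rule unit_ring_eqI)
  have "totient N \<ge> 1" using assms(1) by (simp add: Suc_le_eq)
  then show "cyclic_type (ZFact (int (totient N)))" "cyclic_type (ZFact (int N))"
    using assms(1) by (intro cyclic_type_ZFact; simp)+
  have "units_of (ZFact (int N)) \<cong> add_monoid (cyclic_sum [totient N])"
    by (rule group.iso_sym[OF group_add_monoid[OF ring_cyclic_sum] units_of_ZFact_primroot[OF assms]])
  also have "\<dots> \<cong> add_monoid (ZFact (int (totient N)))"
    by (rule is_ring_iso_add[OF ring_iso_sym[OF ring_ZFact cyclic_sum_single]])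
  finally show "units_of (ZFact (int N)) \<cong> add_monoid (ZFact (int (totient N)))" .
qed

lemma unit_ring_ZFact_odd_prime_power:
  assumes "Factorial_Ring.prime (p::nat)" "odd p"
  shows "unit_ring (ZFact (int (p ^ Suc a))) \<simeq> ZFact (int (p ^ a * (p - 1)))"
proof -
  obtain g where g: "\<forall>k>0. residue_primroot (p ^ k) g"
    using residue_primroot_odd_prime_power_exists[OF assms] .
  have "p ^ Suc a > 1"
    by (rule one_less_power[OF prime_gt_1_nat[OF assms(1)]]) (rule zero_less_Suc)
  moreover have "residue_primroot (p ^ Suc a) g"
    using g by (blast intro: zero_less_Suc)
  ultimately have "unit_ring (ZFact (int (p ^ Suc a))) \<simeq> ZFact (int (totient (p ^ Suc a)))"
    by (rule unit_ring_ZFact_primroot)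
  then show ?thesis
    by (simp only: totient_prime_power_Suc[OF assms(1)])
qed

lemma unit_ring_ZFact_odd_prime:
  assumes "Factorial_Ring.prime (p::nat)" "odd p"
  shows "unit_ring (ZFact (int p)) \<simeq> ZFact (int (p - 1))"
  using unit_ring_ZFact_odd_prime_power[OF assms, of 0] by simp

section \<open>Idempotent rings and iterated units\<close>

text \<open>
  Boolean or trivial; unlike being boolean, this passes to the factors of a product.
\<close>
definition idempotent_ring :: "('a, 'b) ring_scheme \<Rightarrow> bool" where
  "idempotent_ring R \<longleftrightarrow> (\<forall>x\<in>carrier R. x \<otimes>\<^bsub>R\<^esub> x = x)"

lemma boolean_ring_iff: "boolean_ring R \<longleftrightarrow> ring R \<and> \<one>\<^bsub>R\<^esub> \<noteq> \<zero>\<^bsub>R\<^esub> \<and> idempotent_ring R"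
  by (simp add: boolean_ring_def idempotent_ring_def)

lemma idempotent_ring_iso:
  assumes "R \<simeq> S" "idempotent_ring R"
  shows "idempotent_ring S"
proof -
  obtain h where h: "h \<in> ring_iso R S" using assms unfolding is_ring_iso_def by auto
  then have "carrier S = h ` carrier R" by (simp add: ring_iso_def bij_betw_def)
  with assms(2) show ?thesis
    by (auto simp: idempotent_ring_def simp flip: ring_iso_memE(2)[OF h])
qed

lemma boolean_ring_iso:
  assumes "R \<simeq> S" "ring S" "boolean_ring R"
  shows "boolean_ring S"
proof -
  obtain h where h: "h \<in> ring_iso R S" using assms unfolding is_ring_iso_def by auto
  have R: "ring R" "\<one>\<^bsub>R\<^esub> \<noteq> \<zero>\<^bsub>R\<^esub>" using assms(3) by (auto simp: boolean_ring_def)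
  have "\<one>\<^bsub>S\<^esub> = h \<one>\<^bsub>R\<^esub>" "\<zero>\<^bsub>S\<^esub> = h \<zero>\<^bsub>R\<^esub>"
    using h ring_hom_zero[of h R S] R assms(2) by (auto simp: ring_iso_def ring_hom_one)
  moreover have "inj_on h (carrier R)" using h by (simp add: ring_iso_def bij_betw_def)
  ultimately have "\<one>\<^bsub>S\<^esub> \<noteq> \<zero>\<^bsub>S\<^esub>"
    using R inj_onD[of h "carrier R" "\<one>\<^bsub>R\<^esub>" "\<zero>\<^bsub>R\<^esub>"] ring.ring_simprules(2,6)[OF R(1)] by auto
  then show ?thesis
    using assms idempotent_ring_iso by (auto simp: boolean_ring_iff)
qed

lemma idempotent_ring_RDirProd:
  assumes "ring R" "ring S"
  shows "idempotent_ring (RDirProd R S) \<longleftrightarrow> idempotent_ring R \<and> idempotent_ring S"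
proof -
  have "carrier R \<noteq> {}" "carrier S \<noteq> {}" using assms[THEN ring.ring_simprules(2)] by auto
  then show ?thesis
    unfolding idempotent_ring_def by (auto simp: RDirProd_def DirProd_def monoid.defs)
qed

text \<open>
  \<open>2\<^sup>2 = 2\<close> would mean that \<open>n\<close> divides \<open>2\<close>.
\<close>
lemma not_idempotent_ZFact:
  assumes "n > 2"
  shows "\<not> idempotent_ring (ZFact (int n))"
proof
  assume "idempotent_ring (ZFact (int n))"
  then have "ZMod (int n) 2 \<otimes>\<^bsub>ZFact (int n)\<^esub> ZMod (int n) 2 = ZMod (int n) 2"
    unfolding idempotent_ring_def by (rule bspec) (rule ZMod_in_ZFact)
  then have "int n dvd 2" by (simp add: ZMod_eq_iff)
  with assms show False by (auto dest: zdvd_imp_le)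
qed

lemma cyclic_type_imp_zero: "cyclic_type R \<Longrightarrow> \<zero>\<^bsub>R\<^esub> \<in> carrier R"
  using cyclic_type_imp_ring ring.ring_simprules(2) by blast

lemma card_carrier_unit_ring:
  assumes "cyclic_type R"
  shows "card (carrier (unit_ring R)) = card (Units R)"
  using iso_same_card[OF add_monoid_unit_ring[OF assms]] by (simp add: units_of_carrier)

lemma carrier_eq_zeroI:
  assumes "cyclic_type R" "card (carrier R) = 1"
  shows "carrier R = {\<zero>\<^bsub>R\<^esub>}"
  using assms(2) cyclic_type_imp_zero[OF assms(1)] by (auto simp: card_1_singleton_iff)

text \<open>
  Cancel \<open>u\<close> in \<open>u\<^sup>2 = u\<close>.
\<close>
lemma unit_ring_of_idempotent_trivial:
  assumes "cyclic_type R" "idempotent_ring R"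
  shows "card (carrier (unit_ring R)) = 1"
proof -
  interpret ring R using assms(1) by (rule cyclic_type_imp_ring)
  have "u = \<one>\<^bsub>R\<^esub>" if u: "u \<in> Units R" for u
  proof -
    have "u \<otimes>\<^bsub>R\<^esub> u = u \<otimes>\<^bsub>R\<^esub> \<one>\<^bsub>R\<^esub>" using assms(2) u Units_closed by (simp add: idempotent_ring_def)
    with u show ?thesis by (simp only: Units_l_cancel Units_closed one_closed)
  qed
  then have "Units R = {\<one>\<^bsub>R\<^esub>}" by auto
  then show ?thesis by (simp add: card_carrier_unit_ring[OF assms(1)])
qed

lemma trivial_imp_idempotent:
  assumes "cyclic_type R" "card (carrier R) = 1"
  shows "idempotent_ring R"
proof -
  interpret ring R using assms(1) by (rule cyclic_type_imp_ring)
  show ?thesis using carrier_eq_zeroI[OF assms] by (simp add: idempotent_ring_def)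
qed

lemma cyclic_type_iterated_unit_ring: "cyclic_type R \<Longrightarrow> cyclic_type (iterated_unit_ring k R)"
  by (induction k) (simp_all add: cyclic_type_unit_ring)

lemma iterated_unit_ring_trivial:
  assumes "cyclic_type R" "idempotent_ring (iterated_unit_ring k R)" "k < l"
  shows "card (carrier (iterated_unit_ring l R)) = 1"
proof -
  have "card (carrier (iterated_unit_ring (Suc (k + d)) R)) = 1" for d
  proof (induction d)
    case 0
    show ?case
      using unit_ring_of_idempotent_trivial[OF cyclic_type_iterated_unit_ring[OF assms(1)] assms(2)] by simp
  next
    case (Suc d)
    have "idempotent_ring (iterated_unit_ring (Suc (k + d)) R)"
      by (rule trivial_imp_idempotent[OF cyclic_type_iterated_unit_ring[OF assms(1)] Suc])
    from unit_ring_of_idempotent_trivial[OF cyclic_type_iterated_unit_ring[OF assms(1)] this] show ?case by simp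
  qed
  moreover obtain d where "l = Suc (k + d)" using less_imp_Suc_add[OF assms(3)] by blast
  ultimately show ?thesis by blast
qed

lemma iterated_unit_ring_cong:
  assumes "cyclic_type R" "cyclic_type S" "R \<simeq> S"
  shows "iterated_unit_ring k R \<simeq> iterated_unit_ring k S"
  by (induction k) (simp_all add: assms unit_ring_cong cyclic_type_iterated_unit_ring)

lemma iterated_unit_ring_RDirProd:
  assumes "cyclic_type R" "cyclic_type S"
  shows "iterated_unit_ring k (RDirProd R S) \<simeq> RDirProd (iterated_unit_ring k R) (iterated_unit_ring k S)"
proof (induction k)
  case 0
  show ?case unfolding iterated_unit_ring.simps by (rule ring_iso_refl)
next
  case (Suc k)
  have "iterated_unit_ring (Suc k) (RDirProd R S)
      \<simeq> unit_ring (RDirProd (iterated_unit_ring k R) (iterated_unit_ring k S))"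
    unfolding iterated_unit_ring.simps
    using assms by (intro unit_ring_cong[OF _ _ Suc] cyclic_type_iterated_unit_ring cyclic_type_RDirProd)
  also have "\<dots> \<simeq> RDirProd (iterated_unit_ring (Suc k) R) (iterated_unit_ring (Suc k) S)"
    unfolding iterated_unit_ring.simps
    using assms by (intro unit_ring_RDirProd cyclic_type_iterated_unit_ring)
  finally show ?case .
qed

text \<open>
  The recursion defining the iteration takes units last; this form takes them first.
\<close>
lemma iterated_unit_ring_Suc: "iterated_unit_ring (Suc k) R = iterated_unit_ring k (unit_ring R)"
  by (induction k) simp_all

text \<open>
  One step of the recursion: the units modulo \<open>p\<^sup>a\<^sup>+\<^sup>1\<close> form the ring \<open>\<int>/p\<^sup>a \<times> \<int>/(p - 1)\<close>, whose second
  factor is the ring of units of \<open>\<int>/p\<close>.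
\<close>
lemma iterated_unit_ring_prime_power:
  assumes p: "Factorial_Ring.prime (p::nat)" "odd p"
  shows "iterated_unit_ring (Suc k) (ZFact (int (p ^ Suc a))) \<simeq>
         RDirProd (iterated_unit_ring k (ZFact (int (p ^ a)))) (iterated_unit_ring (Suc k) (ZFact (int p)))"
proof -
  have p1: "p > 1" using p(1) by (rule prime_gt_1_nat)
  have ct: "cyclic_type (ZFact (int (p ^ i)))" "cyclic_type (ZFact (int p))" "cyclic_type (ZFact (int (p - 1)))" for i
    using p1 cyclic_type_ZFact[of "p ^ i"] cyclic_type_ZFact[of p] cyclic_type_ZFact[of "p - 1"] by auto
  have "coprime p (p - 1)" using p1 by (intro coprime_diff_one_right_nat) simp
  then have cop: "coprime (int (p ^ a)) (int (p - 1))"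
    unfolding coprime_int_iff by (rule coprime_power_left_iff[THEN iffD2, OF disjI1])
  have "unit_ring (ZFact (int (p ^ Suc a))) \<simeq> ZFact (int (p ^ a) * int (p - 1))"
    using unit_ring_ZFact_odd_prime_power[OF p, of a] by (simp only: of_nat_mult)
  also have "\<dots> \<simeq> RDirProd (ZFact (int (p ^ a))) (ZFact (int (p - 1)))"
    by (rule ZFact_mult_coprime[OF cop])
  also have "\<dots> \<simeq> RDirProd (ZFact (int (p ^ a))) (unit_ring (ZFact (int p)))"
    by (intro RDirProd_cong ring_iso_refl ring_iso_sym[OF _ unit_ring_ZFact_odd_prime[OF p]]
        cyclic_type_imp_ring cyclic_type_unit_ring ct)
  finally have "iterated_unit_ring k (unit_ring (ZFact (int (p ^ Suc a)))) \<simeq>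
      iterated_unit_ring k (RDirProd (ZFact (int (p ^ a))) (unit_ring (ZFact (int p))))"
    by (intro iterated_unit_ring_cong cyclic_type_RDirProd cyclic_type_unit_ring ct)
  also have "\<dots> \<simeq> RDirProd (iterated_unit_ring k (ZFact (int (p ^ a))))
      (iterated_unit_ring k (unit_ring (ZFact (int p))))"
    by (intro iterated_unit_ring_RDirProd cyclic_type_unit_ring ct)
  finally show ?thesis by (simp only: iterated_unit_ring_Suc)
qed

text \<open>
  Each step of the recursion lowers the exponent and the number of iterations by one, and the first
  factor stays idempotent. If the iterations ran out before the exponent reached \<open>1\<close>, then
  \<open>\<int>/p\<^sup>i\<close> with \<open>i \<ge> 2\<close> would be idempotent. At exponent \<open>1\<close>, no iterations left would make \<open>\<int>/p\<close>
  idempotent, and one left would make \<open>\<int>/(p - 1)\<close> idempotent, although \<open>p - 1 > 2\<close>.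
\<close>
lemma idempotent_prime_power_imp:
  assumes p: "Factorial_Ring.prime (p::nat)" "odd p" "p \<noteq> 3"
    and "idempotent_ring (iterated_unit_ring k (ZFact (int (p ^ Suc a))))"
  shows "Suc a < k \<and> idempotent_ring (iterated_unit_ring (k - a) (ZFact (int p)))"
  using assms(4)
proof (induction a arbitrary: k)
  have p2: "p > 3" using p prime_ge_2_nat[OF p(1)] by (cases "p = 2") auto
  {
    case 0
    have "k \<noteq> 0" using 0 not_idempotent_ZFact[of p] p2 by (intro notI) simp
    moreover have "k \<noteq> 1"
    proof
      assume "k = 1"
      then have "idempotent_ring (ZFact (int (p - 1)))"
        using 0 idempotent_ring_iso[OF unit_ring_ZFact_odd_prime[OF p(1,2)]] by simp
      moreover have "p - 1 > 2" using p2 by linarith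
      ultimately show False using not_idempotent_ZFact by blast
    qed
    ultimately show ?case using 0 by simp
  next
    case (Suc a)
    have ct: "cyclic_type (ZFact (int (p ^ i)))" "cyclic_type (ZFact (int p))" for i
      using p2 cyclic_type_ZFact[of "p ^ i"] cyclic_type_ZFact[of p] by auto
    have "p ^ 1 \<le> p ^ Suc (Suc a)" using p2 by (intro power_increasing) auto
    then have "k \<noteq> 0" using Suc.prems not_idempotent_ZFact[of "p ^ Suc (Suc a)"] p2
      by (intro notI) (simp del: power_Suc of_nat_power)
    then obtain j where k: "k = Suc j" by (cases k) auto
    have "idempotent_ring (RDirProd (iterated_unit_ring j (ZFact (int (p ^ Suc a)))) (iterated_unit_ring (Suc j) (ZFact (int p))))"
      by (rule idempotent_ring_iso[OF iterated_unit_ring_prime_power[OF p(1,2)] Suc.prems[unfolded k]])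
    then have "idempotent_ring (iterated_unit_ring j (ZFact (int (p ^ Suc a))))"
      by (simp only: idempotent_ring_RDirProd[OF ct[THEN cyclic_type_iterated_unit_ring, THEN cyclic_type_imp_ring]])
    with Suc.IH[of j] show ?case unfolding k by simp
  }
qed

text \<open>
  The second factor in each step of the recursion is a later group of units of \<open>\<int>/p\<close> than the
  idempotent one, hence trivial.
\<close>
lemma iterated_unit_ring_prime_power_iso:
  assumes p: "Factorial_Ring.prime (p::nat)" "odd p"
    and "Suc a < k" "idempotent_ring (iterated_unit_ring (k - a) (ZFact (int p)))"
  shows "iterated_unit_ring k (ZFact (int (p ^ Suc a))) \<simeq> iterated_unit_ring (k - a) (ZFact (int p))"
  using assms(3,4)
proof (induction a arbitrary: k)
  case 0
  show ?case by (simp add: ring_iso_refl)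
next
  case (Suc a)
  have ct: "cyclic_type (ZFact (int p))" using p(1) by (intro cyclic_type_ZFact prime_ge_1_nat)
  obtain j where k: "k = Suc j" using Suc.prems by (cases k) auto
  let ?V = "\<lambda>i. iterated_unit_ring i (ZFact (int p))"
  have ctV: "cyclic_type (?V i)" for i using ct by (rule cyclic_type_iterated_unit_ring)
  have "card (carrier (?V (Suc j))) = 1"
    using Suc.prems unfolding k by (intro iterated_unit_ring_trivial[OF ct, of "j - a"]) auto
  note triv = carrier_eq_zeroI[OF ctV this]
  have "iterated_unit_ring k (ZFact (int (p ^ Suc (Suc a)))) \<simeq>
      RDirProd (iterated_unit_ring j (ZFact (int (p ^ Suc a)))) (?V (Suc j))"
    unfolding k by (rule iterated_unit_ring_prime_power[OF p])
  also have "\<dots> \<simeq> RDirProd (?V (j - a)) (?V (Suc j))"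
    using Suc unfolding k by (intro RDirProd_cong ring_iso_refl Suc.IH) auto
  also have "\<dots> \<simeq> ?V (j - a)"
    by (rule ring_iso_sym[OF _ RDirProd_trivial[OF _ _ triv]]) (rule cyclic_type_imp_ring[OF ctV])+
  finally show ?case unfolding k by simp
qed

theorem theorem9:
  fixes p k \<alpha> :: nat
  assumes "Factorial_Ring.prime p" and "odd p" and "p \<noteq> 3" and "k \<ge> 1" and "\<alpha> \<ge> 1"
  shows "(boolean_ring (iterated_unit_ring k (ZFact (int (p ^ \<alpha>)))) \<longleftrightarrow>
            \<alpha> < k \<and> boolean_ring (iterated_unit_ring (k - \<alpha> + 1) (ZFact (int p)))) \<and>
         (boolean_ring (iterated_unit_ring k (ZFact (int (p ^ \<alpha>)))) \<longrightarrow>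
            iterated_unit_ring k (ZFact (int (p ^ \<alpha>))) \<simeq>
            iterated_unit_ring (k - \<alpha> + 1) (ZFact (int p)))"
proof -
  obtain a where a: "\<alpha> = Suc a" using assms(5) by (cases \<alpha>) auto
  let ?X = "iterated_unit_ring k (ZFact (int (p ^ \<alpha>)))"
  let ?V = "iterated_unit_ring (k - \<alpha> + 1) (ZFact (int p))"
  have p1: "p \<ge> 1" using assms(1) by (rule prime_ge_1_nat)
  then have ring: "ring ?X" "ring ?V"
    by (intro cyclic_type_imp_ring cyclic_type_iterated_unit_ring cyclic_type_ZFact, simp)+
  have down: "\<alpha> < k \<and> idempotent_ring ?V" if "idempotent_ring ?X"
    using idempotent_prime_power_imp[OF assms(1-3), of k a] that by (auto simp: a Suc_diff_Suc)
  have iso: "?X \<simeq> ?V" if "\<alpha> < k" "idempotent_ring ?V"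
    using iterated_unit_ring_prime_power_iso[OF assms(1,2), of a k] that by (auto simp: a Suc_diff_Suc)
  show ?thesis
  proof (intro conjI iffI impI)
    assume X: "boolean_ring ?X"
    then have V: "\<alpha> < k" "idempotent_ring ?V" using down by (auto simp: boolean_ring_iff)
    show "\<alpha> < k" by fact
    show "?X \<simeq> ?V" by (rule iso[OF V])
    then show "boolean_ring ?V" using ring(2) X by (rule boolean_ring_iso)
  next
    assume "\<alpha> < k \<and> boolean_ring ?V"
    then have "\<alpha> < k" and V: "boolean_ring ?V" by auto
    then have "?X \<simeq> ?V" by (intro iso) (auto simp: boolean_ring_iff)
    then show "boolean_ring ?X"
      using ring_iso_sym[OF ring(1)] ring(1) V by (blast intro: boolean_ring_iso)
  qed
qed

end
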